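(* Let $p$ be a prime, let $G$ be a finite $p$-group, let $A$ be a non-identity cyclic subgroup of $G$ with generator $a$, and let $\varphi$ be the automorphism of $A$ such that $a\varphi=a^{k}$ for some integer $k$ coprime to $p$. Then the HNN-extension $G^{*}=(G,t;\ t^{-1}at=a^{k})$ is residually a finite $p$-group if and only if $k\equiv 1\pmod p$.
   Context: Maps are written on the right. The HNN-extension $(G,t;\ t^{-1}at=a^{k})$ is the group generated by $G$ and a new letter $t$ subject to the relations of $G$ together with $t^{-1}at=a^{k}$; both associated subgroups are equal to $A$. A group is residually a finite $p$-group if for each of its non-identity elements $g$ there is a homomorphism onto a finite $p$-group whose value at $g$ is not $1$. *)

theory Defs
  imports "HOL-Algebra.Elementary_Groups" "HOL-Number_Theory.Cong"
begin

section \<open>Residually finite p-groups\<close>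

definition finite_p_group :: "nat \<Rightarrow> ('a, 'b) monoid_scheme \<Rightarrow> bool" where
  "finite_p_group p G \<longleftrightarrow> group G \<and> finite (carrier G) \<and> (\<exists>n. order G = p ^ n)"

text \<open>
  The quotients are taken with carrier in \<^typ>\<open>nat\<close>. This loses nothing, since they are
  finite; see \<open>ex_nat_quotient\<close> below.
\<close>

definition residually_finite_p_group :: "nat \<Rightarrow> ('a, 'b) monoid_scheme \<Rightarrow> bool" where
  "residually_finite_p_group p G \<longleftrightarrow>
     (\<forall>g \<in> carrier G. g \<noteq> \<one>\<^bsub>G\<^esub> \<longrightarrow>
        (\<exists>(H :: nat monoid) f. finite_p_group p H \<and> f \<in> epi G H \<and> f g \<noteq> \<one>\<^bsub>H\<^esub>))"

lemma ex_nat_quotient: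
  fixes H :: "('c, 'd) monoid_scheme"
  assumes H: "finite_p_group p H" and f: "f \<in> epi G H"
    and g: "g \<in> carrier G" "f g \<noteq> \<one>\<^bsub>H\<^esub>"
  shows "\<exists>(K :: nat monoid) f'. finite_p_group p K \<and> f' \<in> epi G K \<and> f' g \<noteq> \<one>\<^bsub>K\<^esub>"
proof -
  interpret H: group H using H by (simp add: finite_p_group_def)
  have fin: "finite (carrier H)" using H by (simp add: finite_p_group_def)
  obtain h :: "'c \<Rightarrow> nat" where inj: "inj_on h (carrier H)"
    using finite_imp_inj_to_nat_seg[OF fin] by blast
  define i where "i = inv_into (carrier H) h"
  have i: "i (h x) = x" if "x \<in> carrier H" for x
    using that inj by (simp add: i_def)
  define K :: "nat monoid" where
    "K = \<lparr>carrier = h ` carrier H, monoid.mult = (\<lambda>x y. h (i x \<otimes>\<^bsub>H\<^esub> i y)), one = h \<one>\<^bsub>H\<^esub>\<rparr>"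
  have K: "group K"
  proof (rule groupI)
    fix x assume "x \<in> carrier K"
    then obtain u where u: "u \<in> carrier H" "x = h u" by (auto simp: K_def)
    then show "\<exists>y\<in>carrier K. y \<otimes>\<^bsub>K\<^esub> x = \<one>\<^bsub>K\<^esub>"
      by (intro bexI[of _ "h (inv\<^bsub>H\<^esub> u)"]) (auto simp: K_def i)
  qed (auto simp: K_def i H.m_assoc)
  have "order K = order H"
    using card_image[OF inj] by (simp add: K_def order_def)
  then have "finite_p_group p K"
    using H K by (auto simp: finite_p_group_def K_def)
  moreover have "(\<lambda>x. h (f x)) \<in> epi G K"
    using f unfolding epi_def hom_def K_def by (auto simp: i Pi_iff image_image[symmetric])
  moreover have "h (f g) \<noteq> \<one>\<^bsub>K\<^esub>"
    using f g inj by (auto simp: epi_def hom_def K_def inj_on_def Pi_iff)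
  ultimately show ?thesis by blast
qed


section \<open>HNN-extensions with cyclic associated subgroups\<close>

datatype 'a hnn_letter = Base 'a | Stable | Stable_inv

definition hnn_words :: "('a, 'b) monoid_scheme \<Rightarrow> 'a hnn_letter list set" where
  "hnn_words G = lists (Base ` carrier G \<union> {Stable, Stable_inv})"

text \<open>
  Words over the generators, read from left to right, modulo the least congruence generated by
  the multiplication table of \<open>G\<close>, by the cancellation of \<open>t\<close> with its formal
  inverse, and by \<open>t\<^sup>-\<^sup>1at = b\<close>.
\<close>

inductive hnn_cong ::
    "('a, 'b) monoid_scheme \<Rightarrow> 'a \<Rightarrow> 'a \<Rightarrow> 'a hnn_letter list \<Rightarrow> 'a hnn_letter list \<Rightarrow> bool"
  for G (structure) and a b where
  refl: "u \<in> hnn_words G \<Longrightarrow> hnn_cong G a b u u"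
| sym: "hnn_cong G a b u v \<Longrightarrow> hnn_cong G a b v u"
| trans: "hnn_cong G a b u v \<Longrightarrow> hnn_cong G a b v w \<Longrightarrow> hnn_cong G a b u w"
| append: "hnn_cong G a b u u' \<Longrightarrow> hnn_cong G a b v v' \<Longrightarrow> hnn_cong G a b (u @ v) (u' @ v')"
| base_mult: "g \<in> carrier G \<Longrightarrow> h \<in> carrier G \<Longrightarrow> hnn_cong G a b [Base g, Base h] [Base (g \<otimes> h)]"
| base_one: "hnn_cong G a b [Base \<one>] []"
| stable_cancel: "hnn_cong G a b [Stable, Stable_inv] []"
| stable_inv_cancel: "hnn_cong G a b [Stable_inv, Stable] []"
| conj: "hnn_cong G a b [Stable_inv, Base a, Stable] [Base b]"

definition hnn_rel ::
    "('a, 'b) monoid_scheme \<Rightarrow> 'a \<Rightarrow> 'a \<Rightarrow> ('a hnn_letter list \<times> 'a hnn_letter list) set" where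
  "hnn_rel G a b = {(u, v). hnn_cong G a b u v}"

text \<open>The group \<open>(G, t; t\<^sup>-\<^sup>1at = b)\<close>.\<close>

definition HNN :: "('a, 'b) monoid_scheme \<Rightarrow> 'a \<Rightarrow> 'a \<Rightarrow> 'a hnn_letter list set monoid" where
  "HNN G a b =
     \<lparr>carrier = hnn_words G // hnn_rel G a b,
      monoid.mult = (\<lambda>X Y. \<Union>u\<in>X. \<Union>v\<in>Y. hnn_rel G a b `` {u @ v}),
      one = hnn_rel G a b `` {[]}\<rparr>"

locale hnn_base = group G for G (structure) +
  fixes a b
  assumes a_closed [simp]: "a \<in> carrier G" and b_closed [simp]: "b \<in> carrier G"
begin

definition cls :: "'a hnn_letter list \<Rightarrow> 'a hnn_letter list set" where
  "cls u = hnn_rel G a b `` {u}"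

lemma words_simps [simp]:
  "[] \<in> hnn_words G"
  "x # u \<in> hnn_words G \<longleftrightarrow> x \<in> Base ` carrier G \<union> {Stable, Stable_inv} \<and> u \<in> hnn_words G"
  "u @ v \<in> hnn_words G \<longleftrightarrow> u \<in> hnn_words G \<and> v \<in> hnn_words G"
  by (auto simp: hnn_words_def)

lemma cong_words:
  assumes "hnn_cong G a b u v"
  shows "u \<in> hnn_words G \<and> v \<in> hnn_words G"
  using assms by induction auto

lemma equiv_rel: "equiv (hnn_words G) (hnn_rel G a b)"
  by (rule equivI)
    (auto simp: refl_on_def hnn_rel_def sym_def trans_def
      intro: hnn_cong.intros dest: cong_words)

lemma cls_eq_iff:
  assumes "u \<in> hnn_words G" "v \<in> hnn_words G"
  shows "cls u = cls v \<longleftrightarrow> hnn_cong G a b u v"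
  using eq_equiv_class_iff[OF equiv_rel assms] by (simp add: cls_def hnn_rel_def)

lemma carrier_HNN: "carrier (HNN G a b) = cls ` hnn_words G"
  by (auto simp: HNN_def quotient_def cls_def)

lemma one_HNN: "\<one>\<^bsub>HNN G a b\<^esub> = cls []"
  by (simp add: HNN_def cls_def)

lemma mult_HNN:
  assumes "u \<in> hnn_words G" "v \<in> hnn_words G"
  shows "cls u \<otimes>\<^bsub>HNN G a b\<^esub> cls v = cls (u @ v)"
proof -
  have "cls (u' @ v') = cls (u @ v)" if "u' \<in> cls u" "v' \<in> cls v" for u' v'
  proof -
    have "hnn_cong G a b u u'" "hnn_cong G a b v v'"
      using that by (auto simp: cls_def hnn_rel_def)
    then show ?thesis
      by (meson assms cls_eq_iff cong_words hnn_cong.append hnn_cong.sym words_simps(3))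
  qed
  moreover have "u \<in> cls u" "v \<in> cls v"
    using assms by (auto simp: cls_def hnn_rel_def intro: hnn_cong.refl)
  ultimately have "(\<Union>u'\<in>cls u. \<Union>v'\<in>cls v. cls (u' @ v')) = cls (u @ v)"
    by blast
  then show ?thesis
    by (simp add: HNN_def cls_def)
qed

fun inv_letter :: "'a hnn_letter \<Rightarrow> 'a hnn_letter" where
  "inv_letter (Base g) = Base (inv g)"
| "inv_letter Stable = Stable_inv"
| "inv_letter Stable_inv = Stable"

lemma inv_word:
  assumes "u \<in> hnn_words G"
  shows "rev (map inv_letter u) \<in> hnn_words G
    \<and> hnn_cong G a b (rev (map inv_letter u) @ u) []"
  using assms
proof (induction u)
  case Nil
  then show ?case by (auto intro: hnn_cong.refl)
next
  case (Cons x u)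
  let ?v = "rev (map inv_letter u)"
  from Cons have x: "x \<in> Base ` carrier G \<union> {Stable, Stable_inv}" and u: "u \<in> hnn_words G"
    and v: "?v \<in> hnn_words G" "hnn_cong G a b (?v @ u) []" by auto
  have c: "hnn_cong G a b [inv_letter x, x] []"
    using x
  proof (elim UnE imageE insertE emptyE)
    fix g assume "g \<in> carrier G" "x = Base g"
    then show ?thesis
      using hnn_cong.base_mult[of "inv g" G g a b] hnn_cong.base_one[of G a b] hnn_cong.trans
      by fastforce
  qed (auto intro: hnn_cong.intros)
  have "hnn_cong G a b (?v @ [inv_letter x, x] @ u) (?v @ [] @ u)"
    using c u v by (intro hnn_cong.append hnn_cong.refl)
  then have "hnn_cong G a b (?v @ [inv_letter x, x] @ u) []"
    using v hnn_cong.trans by fastforce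
  then show ?case using x v by (auto simp: image_iff)
qed

lemma group_HNN: "group (HNN G a b)"
proof (rule groupI)
  fix x assume "x \<in> carrier (HNN G a b)"
  then obtain u where u: "u \<in> hnn_words G" "x = cls u" by (auto simp: carrier_HNN)
  with inv_word[OF u(1)] show "\<exists>y\<in>carrier (HNN G a b). y \<otimes>\<^bsub>HNN G a b\<^esub> x = \<one>\<^bsub>HNN G a b\<^esub>"
    by (intro bexI[of _ "cls (rev (map inv_letter u))"])
       (auto simp: carrier_HNN mult_HNN one_HNN cls_eq_iff)
qed (auto simp: carrier_HNN mult_HNN one_HNN)

lemma base_hom: "(\<lambda>g. cls [Base g]) \<in> hom G (HNN G a b)"
  by (rule homI) (auto simp: carrier_HNN mult_HNN cls_eq_iff intro: hnn_cong.intros)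

lemma stable_conj:
  "inv\<^bsub>HNN G a b\<^esub> cls [Stable] \<otimes>\<^bsub>HNN G a b\<^esub> cls [Base a] \<otimes>\<^bsub>HNN G a b\<^esub> cls [Stable] = cls [Base b]"
proof -
  interpret N: group "HNN G a b" by (rule group_HNN)
  have "inv\<^bsub>HNN G a b\<^esub> cls [Stable] = cls [Stable_inv]"
    by (rule N.inv_equality)
      (auto simp: carrier_HNN mult_HNN one_HNN cls_eq_iff intro: hnn_cong.intros)
  then show ?thesis
    by (auto simp: mult_HNN cls_eq_iff intro: hnn_cong.intros)
qed

text \<open>Universal property: \<open>HNN G a b\<close> is the group given by the presentation.\<close>

lemma HNN_universal:
  assumes H: "group H" and f: "f \<in> hom G H" and t: "t \<in> carrier H"
    and rel: "inv\<^bsub>H\<^esub> t \<otimes>\<^bsub>H\<^esub> f a \<otimes>\<^bsub>H\<^esub> t = f b"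
  shows "\<exists>F \<in> hom (HNN G a b) H. (\<forall>g \<in> carrier G. F (cls [Base g]) = f g) \<and> F (cls [Stable]) = t"
proof -
  interpret H: group H by (rule H)
  have fc: "f g \<in> carrier H" if "g \<in> carrier G" for g using f that by (auto simp: hom_def)
  define L where "L x = (case x of Base g \<Rightarrow> f g | Stable \<Rightarrow> t | Stable_inv \<Rightarrow> inv\<^bsub>H\<^esub> t)" for x
  define E where "E u = foldr (\<lambda>x y. L x \<otimes>\<^bsub>H\<^esub> y) u \<one>\<^bsub>H\<^esub>" for u
  have E_simps: "E [] = \<one>\<^bsub>H\<^esub>" "E (x # u) = L x \<otimes>\<^bsub>H\<^esub> E u" for x u
    by (simp_all add: E_def)
  have Lc: "L x \<in> carrier H" if "x \<in> Base ` carrier G \<union> {Stable, Stable_inv}" for x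
    using that t fc by (auto simp: L_def)
  have Ec: "E u \<in> carrier H" if "u \<in> hnn_words G" for u
    using that by (induction u) (auto simp: E_simps Lc)
  have Ea: "E (u @ v) = E u \<otimes>\<^bsub>H\<^esub> E v" if "u \<in> hnn_words G" "v \<in> hnn_words G" for u v
    using that
  proof (induction u)
    case (Cons x u)
    then have "L x \<in> carrier H" "E u \<in> carrier H" "E v \<in> carrier H"
      using Lc Ec by auto
    with Cons show ?case by (simp add: E_simps H.m_assoc)
  qed (simp add: E_simps Ec)
  have Econg: "E u = E v" if "hnn_cong G a b u v" for u v
    using that
  proof induction
    case (append u u' v v')
    then show ?case using Ea cong_words by metis
  next
    case (base_mult g h)
    then show ?case using f fc by (simp add: E_simps L_def hom_mult[OF f])
  next
    case base_one
    then show ?case using hom_one[OF f is_group H] by (simp add: E_simps L_def)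
  next
    case conj
    then show ?case using t fc rel by (simp add: E_simps L_def H.m_assoc)
  qed (use t in \<open>auto simp: E_simps L_def\<close>)
  define F where "F X = E (SOME u. u \<in> X)" for X
  have F: "F (cls u) = E u" if "u \<in> hnn_words G" for u
  proof -
    have "u \<in> cls u" using that by (auto simp: cls_def hnn_rel_def intro: hnn_cong.refl)
    then have "(SOME v. v \<in> cls u) \<in> cls u" by (rule someI)
    then have "hnn_cong G a b u (SOME v. v \<in> cls u)"
      by (simp add: cls_def hnn_rel_def)
    then show ?thesis by (simp add: F_def Econg)
  qed
  have "F \<in> hom (HNN G a b) H"
    by (rule homI) (auto simp: carrier_HNN mult_HNN F Ec Ea)
  moreover have "\<forall>g \<in> carrier G. F (cls [Base g]) = f g" "F (cls [Stable]) = t"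
    using t fc by (auto simp: F E_simps L_def)
  ultimately show ?thesis by blast
qed

end

end

theory Submission
  imports Defs "HOL-Algebra.Sylow" "HOL-Algebra.Group_Action" "HOL-Algebra.Multiplicative_Group"
    "HOL-Number_Theory.Residues"
begin

text \<open>
  If the extension is residually a finite \<open>p\<close>-group, some finite \<open>p\<close>-quotient does not
  kill \<open>a\<close>, because \<open>a\<close> acts nontrivially in a permutation action on \<open>G\<close>. In the
  quotient a power \<open>t^(p^s)\<close> is trivial, hence \<open>k^(p^s) = 1\<close> modulo the order of the
  image of \<open>a\<close>, and Fermat gives \<open>k = 1\<close> modulo \<open>p\<close>.

  For the converse, take a normal series of \<open>G\<close> with factors of exponent \<open>p\<close>. An
  \<open>A\<close>-equivariant map \<open>r\<close> from \<open>G\<close> to \<open>A\<close> that respects the series gives the permutation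
  \<open>x \<mapsto> r(x)^(k-1) x\<close> of \<open>G\<close>, which together with the left translations
  generates a finite \<open>p\<close>-group and satisfies the relation of \<open>t^-1\<close>. To detect words with
  many stable letters, a vector over the integers modulo \<open>p^e\<close> is carried along: at a point \<open>x\<close>
  the letter \<open>t\<close> also applies a shear that depends only on the orbit \<open>Ax\<close>. The orbits met
  along a Britton reduced word form a reduced word in a free group, and shears in general position
  separate it from the identity, as in Magnus's embedding.
\<close>

section \<open>Normal series of finite p-groups\<close>

text \<open>A fixed finite set of points cannot see every word: some power of \<open>t\<close> fixes
  all of \<open>G\<close>. The vectors record the letters, and the number of their entries and the
  modulus are chosen only after the word is known.

  Two demands compete. The relation must survive, so the shear may depend on \<open>x\<close> only
  through the orbit \<open>A x\<close>, which \<open>x\<close> and \<open>a x\<close> share. The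
  group generated must stay a p-group, so all generators have to be unitriangular for one filtration
  of the product of \<open>G\<close> with the vectors. This is where k = 1 modulo p enters: for
  \<open>c\<close> in \<open>A\<close> and in \<open>N (Suc i)\<close>, the element c^(k-1) is a
  power of c^p and so lies in \<open>N i\<close>. It is also why \<open>r\<close> must respect every
  term of the series. Orbit representatives chosen freely would give equivariance, but two points
  that are close in the series could then be multiplied by unrelated elements of \<open>A\<close>.

  The map on \<open>G\<close> stands for t^-1 rather than t because it carries \<open>a x\<close> to
  a^k times the image of \<open>x\<close>, and with functions composed from the right this reads
  t^-1 a = a^k t^-1.\<close>

lemma finite_p_groupI:
  assumes p: "prime p" and G: "group G" and fin: "finite (carrier G)"
    and pow: "\<And>x. x \<in> carrier G \<Longrightarrow> \<exists>m::nat. x [^]\<^bsub>G\<^esub> (p ^ m) = \<one>\<^bsub>G\<^esub>"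
  shows "finite_p_group p G"
proof -
  interpret group G by (rule G)
  have pos: "order G > 0" using fin by (simp add: order_gt_0_iff_finite)
  have only_p: "q = p" if q: "prime q" "q dvd order G" for q
  proof -
    \<comment> \<open>Sylow's theorem with exponent 1 is Cauchy's theorem: there is a subgroup of
      order q. A non-identity element of it has order dividing both q and a power of p, so q =
      p.\<close>
    obtain m where "order G = q ^ 1 * m" using q(2) by auto
    then obtain H where H: "subgroup H G" "card H = q"
      using sylow_thm[OF q(1) G _ fin, of 1 m] by auto
    then have "\<not> H \<subseteq> {\<one>\<^bsub>G\<^esub>}"
      using card_mono[of "{\<one>\<^bsub>G\<^esub>}" H] prime_gt_1_nat[OF q(1)] by auto
    then obtain x where x: "x \<in> H" "x \<noteq> \<one>\<^bsub>G\<^esub>" by blast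
    have xG: "x \<in> carrier G" using H(1) x(1) by (rule subgroup.mem_carrier)
    have "x [^]\<^bsub>G\<lparr>carrier := H\<rparr>\<^esub> order (G\<lparr>carrier := H\<rparr>) = \<one>\<^bsub>G\<lparr>carrier := H\<rparr>\<^esub>"
      using x(1) by (intro group.pow_order_eq_1[OF subgroup.subgroup_is_group[OF H(1) G]]) simp
    then have "x [^]\<^bsub>G\<^esub> q = \<one>\<^bsub>G\<^esub>"
      using H(2) nat_pow_consistent[of x q H] by (simp add: order_def)
    then have "ord x dvd q" using pow_eq_id xG by auto
    moreover obtain m where "x [^]\<^bsub>G\<^esub> (p ^ m) = \<one>\<^bsub>G\<^esub>" using pow xG by blast
    then have "ord x dvd p ^ m" using pow_eq_id xG by auto
    moreover have "ord x \<noteq> 1" using ord_eq_1 xG x(2) by auto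
    ultimately show "q = p"
      using p q(1) by (metis divides_primepow_nat dvd_refl prime_dvd_power prime_nat_iff primes_dvd_imp_eq)
  qed
  obtain m where m: "order G = p ^ multiplicity p (order G) * m" "\<not> p dvd m"
    using multiplicity_decompose'[of "order G" p] pos p by (metis less_not_refl not_prime_unit)
  have "m = 1"
  proof (rule ccontr)
    assume "m \<noteq> 1"
    then obtain q where q: "prime q" "q dvd m" using prime_factor_nat by blast
    then have "q = p" using only_p m(1) by (metis dvd_mult)
    then show False using q m(2) by simp
  qed
  then show ?thesis using m(1) fin G by (auto simp: finite_p_group_def)
qed

text \<open>Orbit sizes are powers of p by the orbit-stabilizer theorem, so modulo p only the orbits
  of size one contribute. The two counts are compared orbit by orbit.\<close>

lemma (in group_action) card_fixed_points_cong:
  assumes p: "prime p" and fp: "finite_p_group p G" and fin: "finite E"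
  shows "[card {x \<in> E. \<forall>g \<in> carrier G. \<phi> g x = x} = card E] (mod p)"
proof -
  interpret G: group G using fp by (simp add: finite_p_group_def)
  obtain n where n: "order G = p ^ n" using fp by (auto simp: finite_p_group_def)
  let ?F = "{x \<in> E. \<forall>g \<in> carrier G. \<phi> g x = x}"
  have orb_E: "orb \<subseteq> E" if "orb \<in> orbits G E \<phi>" for orb
    using that orbits_coverture by auto
  have fin_orbs: "finite (orbits G E \<phi>)"
    using fin by (simp add: orbits_def)
  have one: "[(\<Sum>x\<in>orb. if x \<in> ?F then 1 else 0) = card orb] (mod p)"
    if orb: "orb \<in> orbits G E \<phi>" for orb
  proof -
    obtain x where x: "x \<in> E" "orb = orbit G \<phi> x" using orb by (auto simp: orbits_def)
    have fo: "finite orb" using fin orb_E[OF orb] finite_subset by blast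
    have "card orb dvd p ^ n"
      using orbit_stabilizer_theorem[OF x(1)] n x(2) by (metis dvd_triv_left)
    then obtain j where j: "card orb = p ^ j" using divides_primepow_nat[OF p] by auto
    show ?thesis
    proof (cases "orb \<inter> ?F = {}")
      case True
      then have "(\<Sum>x\<in>orb. if x \<in> ?F then 1 else 0) = (0::nat)"
        by (intro sum.neutral) auto
      moreover have "j \<noteq> 0"
      proof
        assume "j = 0"
        then obtain y where "orb = {y}" using j card_1_singleton_iff[of orb] by auto
        then have "orbit G \<phi> x = {x}" using orbit_refl[OF x(1)] x(2) by auto
        then have "x \<in> ?F" using x(1) by (auto simp: orbit_def)
        then show False using True orbit_refl[OF x(1)] x(2) by auto
      qed
      ultimately show ?thesis using j by (auto simp: cong_def)
    next
      case False
      then obtain y where y: "y \<in> orb" "y \<in> ?F" by blast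
      have "x \<in> orbit G \<phi> y" using orbit_sym x y by auto
      then have "x = y" using y(2) by (auto simp: orbit_def)
      then have "orb = {y}" using y(2) x(2) orbit_refl[OF x(1)] by (auto simp: orbit_def)
      then show ?thesis using y(2) by (simp add: cong_def)
    qed
  qed
  have "card ?F = (\<Sum>x\<in>E. if x \<in> ?F then 1 else 0)"
    by (rule card_as_sums) (use fin in auto)
  also have "\<dots> = (\<Sum>orb\<in>orbits G E \<phi>. \<Sum>x\<in>orb. if x \<in> ?F then 1 else 0)"
    by (rule disjoint_sum[OF fin, symmetric])
  also have "[\<dots> = (\<Sum>orb\<in>orbits G E \<phi>. card orb)] (mod p)"
    by (rule cong_sum) (rule one)
  also have "(\<Sum>orb\<in>orbits G E \<phi>. card orb) = card E"
    using disjoint_sum[OF fin, of "\<lambda>_. 1::nat"] by simp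
  finally show ?thesis .
qed

text \<open>The fixed points of conjugation form the centre. Its size is divisible by p and
  positive, so it contains some \<open>x\<close> other than the identity, and the last non-trivial
  term among the powers x^(p^m) has order p.\<close>

lemma ex_central_element_of_order_p:
  assumes p: "prime p" and fp: "finite_p_group p G" and nontriv: "carrier G \<noteq> {\<one>\<^bsub>G\<^esub>}"
  shows "\<exists>z \<in> carrier G. z \<noteq> \<one>\<^bsub>G\<^esub> \<and> z [^]\<^bsub>G\<^esub> p = \<one>\<^bsub>G\<^esub> \<and> (\<forall>g \<in> carrier G. g \<otimes>\<^bsub>G\<^esub> z = z \<otimes>\<^bsub>G\<^esub> g)"
proof -
  interpret group G using fp by (simp add: finite_p_group_def)
  have fin: "finite (carrier G)" using fp by (simp add: finite_p_group_def)
  obtain n where n: "order G = p ^ n" using fp by (auto simp: finite_p_group_def)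
  interpret act: group_action G "carrier G" "\<lambda>g. \<lambda>h \<in> carrier G. g \<otimes>\<^bsub>G\<^esub> h \<otimes>\<^bsub>G\<^esub> inv\<^bsub>G\<^esub> g"
    by (rule action_by_conjugation)
  define F where
    "F = {x \<in> carrier G. \<forall>g \<in> carrier G. (\<lambda>h \<in> carrier G. g \<otimes>\<^bsub>G\<^esub> h \<otimes>\<^bsub>G\<^esub> inv\<^bsub>G\<^esub> g) x = x}"
  have "n \<noteq> 0" using n nontriv order_one_triv_iff by (metis power_0)
  then have "p dvd card (carrier G)" using n by (simp add: order_def)
  then have "p dvd card F"
    using act.card_fixed_points_cong[OF p fp fin] cong_dvd_iff unfolding F_def by blast
  moreover have "\<one>\<^bsub>G\<^esub> \<in> F" by (simp add: F_def)
  moreover have "finite F" using fin by (simp add: F_def)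
  ultimately have "card F \<ge> p" by (intro dvd_imp_le) (auto simp: card_gt_0_iff)
  then have "\<not> F \<subseteq> {\<one>\<^bsub>G\<^esub>}"
    using card_mono[of "{\<one>\<^bsub>G\<^esub>}" F] prime_gt_1_nat[OF p] by auto
  then obtain x where x: "x \<in> F" "x \<noteq> \<one>\<^bsub>G\<^esub>" by blast
  have xG: "x \<in> carrier G" using x by (simp add: F_def)
  have comm: "g \<otimes>\<^bsub>G\<^esub> x = x \<otimes>\<^bsub>G\<^esub> g" if "g \<in> carrier G" for g
  proof -
    have "g \<otimes>\<^bsub>G\<^esub> x \<otimes>\<^bsub>G\<^esub> inv\<^bsub>G\<^esub> g = x" using x that by (auto simp: F_def)
    then show ?thesis using inv_solve_right[of x "g \<otimes>\<^bsub>G\<^esub> x" g, OF xG m_closed[OF that xG] that] by metis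
  qed
  define m where "m = (LEAST m. x [^]\<^bsub>G\<^esub> (p ^ m) = \<one>\<^bsub>G\<^esub>)"
  have "x [^]\<^bsub>G\<^esub> (p ^ n) = \<one>\<^bsub>G\<^esub>" using pow_order_eq_1[OF xG] n by simp
  then have m: "x [^]\<^bsub>G\<^esub> (p ^ m) = \<one>\<^bsub>G\<^esub>" unfolding m_def by (rule LeastI)
  have "m \<noteq> 0" using m x(2) xG by (auto intro: ccontr)
  then obtain m' where m': "m = Suc m'" using not0_implies_Suc by blast
  let ?z = "x [^]\<^bsub>G\<^esub> (p ^ m')"
  have "?z \<noteq> \<one>\<^bsub>G\<^esub>" using not_less_Least[of m' "\<lambda>m. x [^]\<^bsub>G\<^esub> (p ^ m) = \<one>\<^bsub>G\<^esub>"] m' m_def by auto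
  moreover have "?z [^]\<^bsub>G\<^esub> p = \<one>\<^bsub>G\<^esub>" using m m' xG by (simp add: nat_pow_pow mult.commute)
  moreover have "g \<otimes>\<^bsub>G\<^esub> ?z = ?z \<otimes>\<^bsub>G\<^esub> g" if "g \<in> carrier G" for g
    using group_commutes_pow[OF comm[symmetric], of g] that xG by simp
  ultimately show ?thesis using xG by blast
qed

text \<open>\<open>N'\<close> is the preimage of the set \<open>Z\<close> of central elements of the
  quotient whose p-th power is trivial. Elements of \<open>Z\<close> commute, so \<open>Z\<close> is
  a subgroup, and central elements are fixed by conjugation, so \<open>N'\<close> is normal.\<close>

lemma ex_exponent_p_normal_extension:
  assumes p: "prime p" and fp: "finite_p_group p G" and N: "N \<lhd> G" and ne: "N \<noteq> carrier G"
  shows "\<exists>N'. N' \<lhd> G \<and> N \<subset> N' \<and> (\<forall>x \<in> N'. x [^]\<^bsub>G\<^esub> p \<in> N)"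
proof -
  interpret N: normal N G by (rule N)
  have fin: "finite (carrier G)" using fp by (simp add: finite_p_group_def)
  obtain n where n: "order G = p ^ n" using fp by (auto simp: finite_p_group_def)
  define Q where "Q = G Mod N"
  have Q: "group Q" unfolding Q_def by (rule N.factorgroup_is_group)
  have finQ: "finite (carrier Q)"
    using fin by (simp add: Q_def carrier_FactGroup)
  have "order Q * card N = p ^ n"
    using N.lagrange[OF N.subgroup_axioms] n by (simp add: Q_def FactGroup_def order_def)
  then have "order Q dvd p ^ n" by (metis dvd_triv_left)
  then have fpQ: "finite_p_group p Q"
    using Q finQ p by (auto simp: finite_p_group_def divides_primepow_nat)
  interpret pi: group_hom G Q "(#>\<^bsub>G\<^esub>) N"
    using N.r_coset_hom_Mod N.is_group Q by (simp add: group_hom_def group_hom_axioms_def Q_def)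
  have one: "\<one>\<^bsub>Q\<^esub> = N" by (simp add: Q_def)
  have in_N: "x \<in> N \<longleftrightarrow> N #>\<^bsub>G\<^esub> x = \<one>\<^bsub>Q\<^esub>" if "x \<in> carrier G" for x
    using that one N.coset_join1 N.coset_join2 N.subgroup_axioms N.subset by metis
  obtain g where g: "g \<in> carrier G" "g \<notin> N" using ne N.subset by blast
  then have "carrier Q \<noteq> {\<one>\<^bsub>Q\<^esub>}" using in_N pi.hom_closed by blast
  from ex_central_element_of_order_p[OF p fpQ this]
  obtain z where z: "z \<in> carrier Q" "z \<noteq> \<one>\<^bsub>Q\<^esub>" "z [^]\<^bsub>Q\<^esub> p = \<one>\<^bsub>Q\<^esub>"
    "\<And>g. g \<in> carrier Q \<Longrightarrow> g \<otimes>\<^bsub>Q\<^esub> z = z \<otimes>\<^bsub>Q\<^esub> g" by blast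
  define Z where "Z = {z \<in> carrier Q. z [^]\<^bsub>Q\<^esub> p = \<one>\<^bsub>Q\<^esub> \<and> (\<forall>g \<in> carrier Q. g \<otimes>\<^bsub>Q\<^esub> z = z \<otimes>\<^bsub>Q\<^esub> g)}"
  define N' where "N' = {x \<in> carrier G. N #>\<^bsub>G\<^esub> x \<in> Z}"
  have Z_mult: "x \<otimes>\<^bsub>Q\<^esub> y \<in> Z" if "x \<in> Z" "y \<in> Z" for x y
  proof -
    have c: "x \<in> carrier Q" "y \<in> carrier Q" "x [^]\<^bsub>Q\<^esub> p = \<one>\<^bsub>Q\<^esub>" "y [^]\<^bsub>Q\<^esub> p = \<one>\<^bsub>Q\<^esub>" "x \<otimes>\<^bsub>Q\<^esub> y = y \<otimes>\<^bsub>Q\<^esub> x"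
      and cx: "\<And>g. g \<in> carrier Q \<Longrightarrow> g \<otimes>\<^bsub>Q\<^esub> x = x \<otimes>\<^bsub>Q\<^esub> g"
      and cy: "\<And>g. g \<in> carrier Q \<Longrightarrow> g \<otimes>\<^bsub>Q\<^esub> y = y \<otimes>\<^bsub>Q\<^esub> g"
      using that unfolding Z_def by blast+
    have "(x \<otimes>\<^bsub>Q\<^esub> y) [^]\<^bsub>Q\<^esub> p = \<one>\<^bsub>Q\<^esub>"
      using pi.H.pow_mult_distrib[OF c(5,1,2)] c by simp
    moreover have "g \<otimes>\<^bsub>Q\<^esub> (x \<otimes>\<^bsub>Q\<^esub> y) = (x \<otimes>\<^bsub>Q\<^esub> y) \<otimes>\<^bsub>Q\<^esub> g" if "g \<in> carrier Q" for g
      using c(1,2) that cx[OF that] cy[OF that] pi.H.m_assoc by metis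
    ultimately show ?thesis using c by (simp add: Z_def)
  qed
  have Z_inv: "inv\<^bsub>Q\<^esub> x \<in> Z" if "x \<in> Z" for x
  proof -
    have x: "x \<in> carrier Q" "x [^]\<^bsub>Q\<^esub> p = \<one>\<^bsub>Q\<^esub>" "\<And>g. g \<in> carrier Q \<Longrightarrow> g \<otimes>\<^bsub>Q\<^esub> x = x \<otimes>\<^bsub>Q\<^esub> g"
      using that unfolding Z_def by blast+
    have "g \<otimes>\<^bsub>Q\<^esub> inv\<^bsub>Q\<^esub> x = inv\<^bsub>Q\<^esub> x \<otimes>\<^bsub>Q\<^esub> g" if "g \<in> carrier Q" for g
    proof -
      have "x \<otimes>\<^bsub>Q\<^esub> (g \<otimes>\<^bsub>Q\<^esub> inv\<^bsub>Q\<^esub> x) = g \<otimes>\<^bsub>Q\<^esub> x \<otimes>\<^bsub>Q\<^esub> inv\<^bsub>Q\<^esub> x"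
        using x(1) that by (simp add: x(3)[OF that] pi.H.m_assoc)
      also have "\<dots> = g" using x(1) that by (simp add: pi.H.m_assoc)
      finally show ?thesis using x(1) that by (simp add: pi.H.inv_solve_left)
    qed
    with x show ?thesis unfolding Z_def using pi.H.nat_pow_inv[OF x(1), of p] by simp
  qed
  have Z_one: "\<one>\<^bsub>Q\<^esub> \<in> Z" by (simp add: Z_def)
  have "subgroup N' G"
  proof (rule N.subgroupI)
    show "N' \<noteq> {}" using Z_one pi.hom_one N.one_closed unfolding N'_def by force
  qed (auto simp: N'_def intro: Z_mult Z_inv)
  moreover have "g \<otimes>\<^bsub>G\<^esub> x \<otimes>\<^bsub>G\<^esub> inv\<^bsub>G\<^esub> g \<in> N'" if "g \<in> carrier G" "x \<in> N'" for g x
  proof -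
    have c: "g \<in> carrier G" "x \<in> carrier G" "N #>\<^bsub>G\<^esub> x \<in> Z" using that by (auto simp: N'_def)
    then have "(N #>\<^bsub>G\<^esub> g) \<otimes>\<^bsub>Q\<^esub> (N #>\<^bsub>G\<^esub> x) = (N #>\<^bsub>G\<^esub> x) \<otimes>\<^bsub>Q\<^esub> (N #>\<^bsub>G\<^esub> g)"
      by (simp add: Z_def)
    then have "N #>\<^bsub>G\<^esub> (g \<otimes>\<^bsub>G\<^esub> x \<otimes>\<^bsub>G\<^esub> inv\<^bsub>G\<^esub> g) = N #>\<^bsub>G\<^esub> x"
      using c by (simp add: pi.H.m_assoc)
    then show ?thesis using c by (simp add: N'_def)
  qed
  ultimately have "N' \<lhd> G" by (intro N.normal_invI)
  moreover have "N \<subseteq> N'" using in_N Z_one N.subset by (auto simp: N'_def)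
  moreover have "N' \<noteq> N"
  proof -
    obtain x where x: "x \<in> carrier G" "z = N #>\<^bsub>G\<^esub> x"
      using z(1) by (auto simp: Q_def carrier_FactGroup)
    then have "x \<in> N'" "x \<notin> N" using z in_N by (auto simp: N'_def Z_def)
    then show ?thesis by blast
  qed
  moreover have "x [^]\<^bsub>G\<^esub> p \<in> N" if "x \<in> N'" for x
    using that in_N by (auto simp: N'_def Z_def pi.hom_nat_pow)
  ultimately show ?thesis by blast
qed

text \<open>The exponent is a parameter because it takes three values: p for the series of
  \<open>G\<close>, \<open>p ^ e\<close> when that series is joined to vectors modulo
  \<open>p ^ e\<close>, and the order of \<open>G\<close> for the series with a single step.\<close>

definition exp_series :: "nat \<Rightarrow> ('a, 'b) monoid_scheme \<Rightarrow> nat \<Rightarrow> (nat \<Rightarrow> 'a set) \<Rightarrow> bool" where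
  "exp_series q G n N \<longleftrightarrow>
     N 0 = {\<one>\<^bsub>G\<^esub>} \<and> N n = carrier G \<and>
     (\<forall>i. N i \<lhd> G \<and> N i \<subseteq> N (Suc i) \<and> (\<forall>x \<in> N (Suc i). x [^]\<^bsub>G\<^esub> q \<in> N i))"

lemma ex_exp_series:
  assumes p: "prime p" and fp: "finite_p_group p G"
  shows "\<exists>n N. exp_series p G n N"
proof -
  interpret group G using fp by (simp add: finite_p_group_def)
  have fin: "finite (carrier G)" using fp by (simp add: finite_p_group_def)
  have "\<exists>n M. M 0 = N \<and> M n = carrier G \<and>
      (\<forall>i. M i \<lhd> G \<and> M i \<subseteq> M (Suc i) \<and> (\<forall>x \<in> M (Suc i). x [^]\<^bsub>G\<^esub> p \<in> M i))"
    if "N \<lhd> G" for N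
    using that
  proof (induction "card (carrier G) - card N" arbitrary: N rule: less_induct)
    case less
    show ?case
    proof (cases "N = carrier G")
      case True
      then show ?thesis
        using less.prems by (intro exI[of _ "0::nat"] exI[of _ "\<lambda>_. N"]) auto
    next
      case False
      from ex_exponent_p_normal_extension[OF p fp less.prems False]
      obtain N' where N': "N' \<lhd> G" "N \<subset> N'" "\<forall>x \<in> N'. x [^]\<^bsub>G\<^esub> p \<in> N" by blast
      have sub: "N' \<subseteq> carrier G" using N'(1) by (simp add: normal_imp_subgroup subgroup.subset)
      then have "card N < card N'" "card N' \<le> card (carrier G)"
        using N'(2) fin by (auto intro: psubset_card_mono card_mono finite_subset)
      then have "card (carrier G) - card N' < card (carrier G) - card N" by linarith
      from less.hyps[OF this N'(1)] obtain n M where M: "M 0 = N'" "M n = carrier G"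
        "\<And>i. M i \<lhd> G \<and> M i \<subseteq> M (Suc i) \<and> (\<forall>x \<in> M (Suc i). x [^]\<^bsub>G\<^esub> p \<in> M i)" by blast
      show ?thesis
        by (rule exI[of _ "Suc n"], rule exI[of _ "case_nat N M"])
          (use M N' less.prems in \<open>auto split: nat.split\<close>)
    qed
  qed
  from this[OF one_is_normal] show ?thesis unfolding exp_series_def by blast
qed

section \<open>Permutations compatible with a normal series\<close>

lemma mult_BijGroup_apply:
  assumes "f \<in> Bij S" "g \<in> Bij S" "x \<in> S"
  shows "(f \<otimes>\<^bsub>BijGroup S\<^esub> g) x = f (g x)"
  using assms by (simp add: BijGroup_def compose_def)

lemma Bij_closed: "f \<in> Bij S \<Longrightarrow> x \<in> S \<Longrightarrow> f x \<in> S"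
  using Bij_imp_funcset by (blast dest: funcset_mem)

lemma carrier_BijGroup: "carrier (BijGroup S) = Bij S"
  by (simp add: BijGroup_def)

lemma finite_Bij:
  assumes "finite S" shows "finite (Bij S)"
proof (rule finite_subset)
  show "Bij S \<subseteq> S \<rightarrow>\<^sub>E S"
    using Bij_imp_funcset Bij_imp_extensional by (force simp: PiE_def)
  show "finite (S \<rightarrow>\<^sub>E S)" using assms by (simp add: finite_PiE)
qed

text \<open>These are the unitriangular permutations of the series: on a coset of
  \<open>N (Suc i)\<close>, read modulo \<open>N i\<close>, such a map is a left translation. Left
  translations by elements of \<open>G\<close> satisfy the condition with equality.\<close>

definition series_perms :: "('a, 'b) monoid_scheme \<Rightarrow> (nat \<Rightarrow> 'a set) \<Rightarrow> ('a \<Rightarrow> 'a) set" where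
  "series_perms G N =
     {\<sigma> \<in> Bij (carrier G). \<forall>i. \<forall>x \<in> carrier G. \<forall>y \<in> carrier G.
        inv\<^bsub>G\<^esub> x \<otimes>\<^bsub>G\<^esub> y \<in> N (Suc i) \<longrightarrow>
        N i #>\<^bsub>G\<^esub> (inv\<^bsub>G\<^esub> \<sigma> x \<otimes>\<^bsub>G\<^esub> \<sigma> y) = N i #>\<^bsub>G\<^esub> (inv\<^bsub>G\<^esub> x \<otimes>\<^bsub>G\<^esub> y)}"

abbreviation series_perm_group ::
    "('a, 'b) monoid_scheme \<Rightarrow> (nat \<Rightarrow> 'a set) \<Rightarrow> ('a \<Rightarrow> 'a) monoid" where
  "series_perm_group G N \<equiv> BijGroup (carrier G)\<lparr>carrier := series_perms G N\<rparr>"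

lemma (in group) inv_mult_telescope:
  assumes "x \<in> carrier G" "y \<in> carrier G" "z \<in> carrier G"
  shows "(inv x \<otimes> y) \<otimes> (inv y \<otimes> z) = inv x \<otimes> z"
proof -
  have "(inv x \<otimes> y) \<otimes> (inv y \<otimes> z) = inv x \<otimes> (y \<otimes> inv y \<otimes> z)"
    using assms by (simp only: m_assoc inv_closed m_closed)
  then show ?thesis using assms by simp
qed

locale finite_exp_series = group G for G (structure) +
  fixes q n :: nat and N :: "nat \<Rightarrow> 'a set"
  assumes fin: "finite (carrier G)" and series: "exp_series q G n N"
begin

sublocale B: group "BijGroup (carrier G)" by (rule group_BijGroup)

lemma N_normal: "N i \<lhd> G" and N_mono: "N i \<subseteq> N (Suc i)"
  and N_pow: "x \<in> N (Suc i) \<Longrightarrow> x [^] q \<in> N i"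
  and N_0: "N 0 = {\<one>}" and N_n: "N n = carrier G"
  using series by (auto simp: exp_series_def)

lemma N_subgroup: "subgroup (N i) G"
  using N_normal by (rule normal_imp_subgroup)

lemma N_coset_mult:
  assumes "x \<in> carrier G" "y \<in> carrier G" "x' \<in> carrier G" "y' \<in> carrier G"
    and "N i #> x = N i #> x'" "N i #> y = N i #> y'"
  shows "N i #> (x \<otimes> y) = N i #> (x' \<otimes> y')"
  using assms normal.rcos_sum[OF N_normal[of i]] by metis

lemma N_coset_one_iff: "x \<in> carrier G \<Longrightarrow> N i #> x = N i \<longleftrightarrow> x \<in> N i"
  using coset_join1 coset_join2 N_subgroup subgroup.subset by metis

lemma series_permsD:
  assumes "\<sigma> \<in> series_perms G N"
  shows "\<sigma> \<in> Bij (carrier G)" "x \<in> carrier G \<Longrightarrow> \<sigma> x \<in> carrier G"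
    "x \<in> carrier G \<Longrightarrow> y \<in> carrier G \<Longrightarrow> inv x \<otimes> y \<in> N (Suc i) \<Longrightarrow>
       N i #> (inv \<sigma> x \<otimes> \<sigma> y) = N i #> (inv x \<otimes> y)"
  using assms by (auto simp: series_perms_def intro: Bij_closed)

lemma series_perms_preserve:
  assumes "\<sigma> \<in> series_perms G N" "x \<in> carrier G" "y \<in> carrier G" "inv x \<otimes> y \<in> N (Suc i)"
  shows "inv \<sigma> x \<otimes> \<sigma> y \<in> N (Suc i)"
proof -
  have c: "inv x \<otimes> y \<in> carrier G" "inv \<sigma> x \<otimes> \<sigma> y \<in> carrier G"
    using assms series_permsD(2)[OF assms(1)] by auto
  have "inv \<sigma> x \<otimes> \<sigma> y \<in> N i #> (inv x \<otimes> y)"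
    using series_permsD(3)[OF assms] rcos_self[OF c(2) N_subgroup[of i]] by simp
  then obtain h where "h \<in> N i" "inv \<sigma> x \<otimes> \<sigma> y = h \<otimes> (inv x \<otimes> y)"
    by (auto simp: r_coset_def)
  then show ?thesis
    using assms(4) N_mono subgroup.m_closed[OF N_subgroup[of "Suc i"]] by auto
qed

lemma series_perms_mult:
  assumes "\<sigma> \<in> series_perms G N" "\<tau> \<in> series_perms G N"
  shows "\<sigma> \<otimes>\<^bsub>BijGroup (carrier G)\<^esub> \<tau> \<in> series_perms G N"
proof -
  note D = series_permsD[OF assms(1)] series_permsD[OF assms(2)]
  have "\<sigma> \<otimes>\<^bsub>BijGroup (carrier G)\<^esub> \<tau> \<in> Bij (carrier G)"
    using D(1,4) B.m_closed by (simp add: carrier_BijGroup)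
  moreover have "N i #> (inv \<sigma> (\<tau> x) \<otimes> \<sigma> (\<tau> y)) = N i #> (inv x \<otimes> y)"
    if "x \<in> carrier G" "y \<in> carrier G" "inv x \<otimes> y \<in> N (Suc i)" for i x y
    using that D series_perms_preserve[OF assms(2)] by simp
  ultimately show ?thesis
    using D by (simp add: series_perms_def mult_BijGroup_apply)
qed

lemma series_perms_one: "\<one>\<^bsub>BijGroup (carrier G)\<^esub> \<in> series_perms G N"
  using id_Bij[of "carrier G"] by (simp add: BijGroup_def series_perms_def)

lemma series_perms_pow:
  assumes "\<sigma> \<in> series_perms G N"
  shows "\<sigma> [^]\<^bsub>BijGroup (carrier G)\<^esub> (m::nat) \<in> series_perms G N"
  by (induction m) (use assms series_perms_one series_perms_mult in auto)

text \<open>Consecutive points of the trajectory of \<open>x\<close> differ by an element of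
  \<open>N (Suc i)\<close>, so \<open>\<sigma>\<close> preserves their quotient modulo
  \<open>N i\<close>. All steps of the trajectory therefore agree modulo \<open>N i\<close>, and m
  of them multiply to an m-th power.\<close>

lemma series_perms_pow_step:
  assumes s: "\<sigma> \<in> series_perms G N" and x: "x \<in> carrier G"
    and step: "\<And>x. x \<in> carrier G \<Longrightarrow> inv x \<otimes> \<sigma> x \<in> N (Suc i)"
  shows "N i #> (inv x \<otimes> (\<sigma> [^]\<^bsub>BijGroup (carrier G)\<^esub> (m::nat)) x) = N i #> (inv x \<otimes> \<sigma> x) [^] m"
proof -
  let ?y = "\<lambda>m::nat. (\<sigma> [^]\<^bsub>BijGroup (carrier G)\<^esub> m) x"
  note D = series_permsD[OF s]
  have sc: "\<sigma> \<in> carrier (BijGroup (carrier G))" using D(1) by (simp add: carrier_BijGroup)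
  have yc: "?y m \<in> carrier G" for m using series_permsD(2)[OF series_perms_pow[OF s] x] .
  have ySuc: "?y (Suc m) = \<sigma> (?y m)" for m
    using B.nat_pow_Suc2[OF sc, of m] mult_BijGroup_apply[OF D(1) _ x]
      series_permsD(1)[OF series_perms_pow[OF s]] by simp
  have y0: "?y 0 = x" using x by (simp add: BijGroup_def)
  have d: "N i #> (inv ?y m \<otimes> ?y (Suc m)) = N i #> (inv x \<otimes> \<sigma> x)" for m
  proof (induction m)
    case 0
    show ?case using ySuc[of 0] y0 by simp
  next
    case (Suc m)
    have "inv ?y m \<otimes> ?y (Suc m) \<in> N (Suc i)" using step[OF yc[of m]] ySuc[of m] by simp
    from D(3)[OF yc yc this] show ?case using Suc.IH by (simp only: ySuc)
  qed
  have "N i #> (inv x \<otimes> ?y m) = N i #> (inv x \<otimes> \<sigma> x) [^] m" for m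
  proof (induction m)
    case 0
    then show ?case using y0 x by simp
  next
    case (Suc m)
    have "inv x \<otimes> ?y (Suc m) = (inv x \<otimes> ?y m) \<otimes> (inv ?y m \<otimes> ?y (Suc m))"
      using inv_mult_telescope[OF x yc yc, symmetric] .
    also have "N i #> \<dots> = N i #> ((inv x \<otimes> \<sigma> x) [^] m \<otimes> (inv x \<otimes> \<sigma> x))"
      using x yc[of m] yc[of "Suc m"] D(2)[OF x] Suc.IH d by - (rule N_coset_mult, auto)
    finally show ?case by simp
  qed
  then show ?thesis .
qed

text \<open>Each further q-th power moves the displacement of every point one term down the series,
  from \<open>N n\<close> to the trivial group in n rounds.\<close>

lemma series_perms_exponent:
  assumes s: "\<sigma> \<in> series_perms G N"
  shows "\<sigma> [^]\<^bsub>BijGroup (carrier G)\<^esub> (q ^ n) = \<one>\<^bsub>BijGroup (carrier G)\<^esub>"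
proof -
  have sc: "\<sigma> \<in> carrier (BijGroup (carrier G))" using series_permsD[OF s] by (simp add: carrier_BijGroup)
  have *: "inv x \<otimes> (\<sigma> [^]\<^bsub>BijGroup (carrier G)\<^esub> (q ^ j)) x \<in> N (n - j)" if "j \<le> n" "x \<in> carrier G" for j x
    using that
  proof (induction j arbitrary: x)
    case 0
    then show ?case using N_n series_permsD(2)[OF s] sc by simp
  next
    case (Suc j)
    let ?r = "\<sigma> [^]\<^bsub>BijGroup (carrier G)\<^esub> (q ^ j)"
    have r: "?r \<in> series_perms G N" by (rule series_perms_pow[OF s])
    have i: "n - j = Suc (n - Suc j)" using Suc.prems by simp
    have st: "inv y \<otimes> ?r y \<in> N (Suc (n - Suc j))" if "y \<in> carrier G" for y
      using Suc.IH[of y] Suc.prems that i by simp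
    have c: "inv x \<otimes> ?r x \<in> carrier G" using series_permsD(2)[OF r] Suc.prems by simp
    have "N (n - Suc j) #> (inv x \<otimes> (?r [^]\<^bsub>BijGroup (carrier G)\<^esub> q) x) = N (n - Suc j) #> (inv x \<otimes> ?r x) [^] q"
      by (rule series_perms_pow_step[OF r Suc.prems(2) st])
    also have "\<dots> = N (n - Suc j)"
      using N_pow[OF st[OF Suc.prems(2)]] N_coset_one_iff c by simp
    also have "?r [^]\<^bsub>BijGroup (carrier G)\<^esub> q = \<sigma> [^]\<^bsub>BijGroup (carrier G)\<^esub> (q ^ Suc j)"
      using B.nat_pow_pow[OF sc] by (simp add: mult.commute)
    finally show ?case
      using N_coset_one_iff series_permsD(2)[OF series_perms_pow[OF s]] Suc.prems(2) by simp
  qed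
  show ?thesis
  proof
    fix x
    show "(\<sigma> [^]\<^bsub>BijGroup (carrier G)\<^esub> (q ^ n)) x = \<one>\<^bsub>BijGroup (carrier G)\<^esub> x"
    proof (cases "x \<in> carrier G")
      case True
      let ?y = "(\<sigma> [^]\<^bsub>BijGroup (carrier G)\<^esub> (q ^ n)) x"
      have y: "?y \<in> carrier G" using series_permsD(2)[OF series_perms_pow[OF s] True] .
      have "inv x \<otimes> ?y = \<one>" using *[of n x] True N_0 by simp
      then have "?y = x" using y True by (metis inv_closed inv_equality inv_inv)
      then show ?thesis using True by (simp add: BijGroup_def)
    next
      case False
      have "\<sigma> [^]\<^bsub>BijGroup (carrier G)\<^esub> (q ^ n) \<in> extensional (carrier G)"
        using series_permsD(1)[OF series_perms_pow[OF s]] by (rule Bij_imp_extensional)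
      from extensional_arb[OF this False] show ?thesis using False by (simp add: BijGroup_def)
    qed
  qed
qed

text \<open>Since the exponent is finite, an inverse is a positive power or the identity, so closure
  under products already gives closure under inverses.\<close>

lemma subgroup_series_perms:
  assumes q: "q > 0"
  shows "subgroup (series_perms G N) (BijGroup (carrier G))"
proof (rule B.subgroupI)
  show "series_perms G N \<subseteq> carrier (BijGroup (carrier G))"
    by (auto simp: series_perms_def carrier_BijGroup)
  show "series_perms G N \<noteq> {}" using series_perms_one by blast
  fix \<sigma> assume s: "\<sigma> \<in> series_perms G N"
  have sc: "\<sigma> \<in> carrier (BijGroup (carrier G))" using series_permsD[OF s] by (simp add: carrier_BijGroup)
  have "Suc (q ^ n - 1) = q ^ n" using q by simp
  then have "\<sigma> [^]\<^bsub>BijGroup (carrier G)\<^esub> (q ^ n - 1) \<otimes>\<^bsub>BijGroup (carrier G)\<^esub> \<sigma> = \<one>\<^bsub>BijGroup (carrier G)\<^esub>"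
    using series_perms_exponent[OF s] by (metis B.nat_pow_Suc)
  then have "inv\<^bsub>BijGroup (carrier G)\<^esub> \<sigma> = \<sigma> [^]\<^bsub>BijGroup (carrier G)\<^esub> (q ^ n - 1)"
    using sc by (intro B.inv_equality) auto
  then show "inv\<^bsub>BijGroup (carrier G)\<^esub> \<sigma> \<in> series_perms G N"
    using series_perms_pow[OF s] by simp
qed (rule series_perms_mult)

lemma finite_p_group_series_perms:
  assumes p: "prime p" and q: "q = p ^ e"
  shows "finite_p_group p (series_perm_group G N)"
proof (rule finite_p_groupI[OF p])
  have "q > 0" using p q by (simp add: prime_gt_0_nat)
  then show "group (series_perm_group G N)"
    using subgroup.subgroup_is_group[OF subgroup_series_perms B.is_group] by blast
  show "finite (carrier (series_perm_group G N))"
    using finite_Bij[OF fin] by (simp add: series_perms_def)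
  fix \<sigma> assume "\<sigma> \<in> carrier (series_perm_group G N)"
  then have "\<sigma> [^]\<^bsub>BijGroup (carrier G)\<^esub> (q ^ n) = \<one>\<^bsub>BijGroup (carrier G)\<^esub>"
    using series_perms_exponent by simp
  then show "\<exists>m::nat. \<sigma> [^]\<^bsub>series_perm_group G N\<^esub> (p ^ m) = \<one>\<^bsub>series_perm_group G N\<^esub>"
    using q B.nat_pow_consistent[of \<sigma> "q ^ n" "series_perms G N"]
    by (intro exI[of _ "e * n"]) (simp add: power_mult)
qed


section \<open>Equivariant maps compatible with the series\<close>

lemma N_coset_eq_iff:
  assumes "x \<in> carrier G" "y \<in> carrier G"
  shows "N i #> x = N i #> y \<longleftrightarrow> inv x \<otimes> y \<in> N i"
proof
  assume "N i #> x = N i #> y"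
  then have "N i #> (inv x \<otimes> x) = N i #> (inv x \<otimes> y)"
    using assms by - (rule N_coset_mult, auto)
  then show "inv x \<otimes> y \<in> N i"
    using assms N_coset_one_iff[of "inv x \<otimes> y"] N_coset_one_iff[of \<one> i]
      subgroup.one_closed[OF N_subgroup] by simp
next
  assume "inv x \<otimes> y \<in> N i"
  then have "N i #> (x \<otimes> (inv x \<otimes> y)) = N i #> (x \<otimes> \<one>)"
    using assms N_coset_one_iff[of "inv x \<otimes> y"] N_coset_one_iff[of \<one> i]
      subgroup.one_closed[OF N_subgroup] by - (rule N_coset_mult, auto)
  then show "N i #> x = N i #> y" using assms by (simp add: m_assoc[symmetric])
qed

lemma N_coset_right_cancel:
  assumes "x \<in> carrier G" "y \<in> carrier G" "z \<in> carrier G" "N i #> (x \<otimes> z) = N i #> (y \<otimes> z)"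
  shows "N i #> x = N i #> y"
proof -
  have "N i #> (x \<otimes> z \<otimes> inv z) = N i #> (y \<otimes> z \<otimes> inv z)"
    using assms by - (rule N_coset_mult, auto)
  then show ?thesis using assms by (simp add: m_assoc)
qed

lemma N_coset_mono:
  assumes "i \<le> j" "x \<in> carrier G" "y \<in> carrier G" "N i #> x = N i #> y"
  shows "N j #> x = N j #> y"
  using assms N_coset_eq_iff lift_Suc_mono_le[of N, OF N_mono assms(1)] by blast

text \<open>
  Built from the top of the series downwards: modulo \<open>N i\<close>, the old map is kept at one
  representative of each orbit of \<open>A\<close> on \<open>G / N i\<close> and extended by equivariance.
\<close>

lemma ex_equivariant_map:
  assumes A: "subgroup A G"
  shows "\<exists>r. (\<forall>x \<in> carrier G. r x \<in> A) \<and>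
     (\<forall>c \<in> A. \<forall>x \<in> carrier G. r (c \<otimes> x) = c \<otimes> r x) \<and>
     (\<forall>i. \<forall>x \<in> carrier G. \<forall>y \<in> carrier G. N i #> x = N i #> y \<longrightarrow> N i #> r x = N i #> r y)"
proof -
  have AG: "c \<in> carrier G" if "c \<in> A" for c using A that by (rule subgroup.mem_carrier)
  note Ac = subgroup.m_closed[OF A] subgroup.m_inv_closed[OF A] subgroup.one_closed[OF A]
  \<comment> \<open>Equivariance is asked only modulo \<open>N i\<close>, compatibility at level i
    and at all levels above. A step down sharpens the first demand and adds one level to the
    second.\<close>
  define P where "P i r \<longleftrightarrow> (\<forall>x \<in> carrier G. r x \<in> A) \<and>
     (\<forall>c \<in> A. \<forall>x \<in> carrier G. N i #> r (c \<otimes> x) = N i #> (c \<otimes> r x)) \<and>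
     (\<forall>j \<ge> i. \<forall>x \<in> carrier G. \<forall>y \<in> carrier G. N j #> x = N j #> y \<longrightarrow> N j #> r x = N j #> r y)"
    for i r
  have step: "\<exists>r. P i r" if ex: "\<exists>r. P (Suc i) r" for i
  proof -
    obtain r where r: "P (Suc i) r" using ex by blast
    note rA = r[unfolded P_def, THEN conjunct1, rule_format]
      and r_eq = r[unfolded P_def, THEN conjunct2, THEN conjunct1, rule_format]
      and r_cong = r[unfolded P_def, THEN conjunct2, THEN conjunct2, rule_format]
    define orb where "orb x = {y \<in> carrier G. \<exists>c \<in> A. N i #> y = N i #> (c \<otimes> x)}" for x
    define rep where "rep x = (SOME y. y \<in> orb x)" for x
    define co where "co x = (SOME c. c \<in> A \<and> N i #> x = N i #> (c \<otimes> rep x))" for x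
    define r' where "r' x = co x \<otimes> r (rep x)" for x
    have rep: "rep x \<in> orb x" if "x \<in> carrier G" for x
    proof -
      have "x \<in> orb x" using that Ac(3) by (auto simp: orb_def intro!: bexI[of _ \<one>])
      then show ?thesis unfolding rep_def by (rule someI)
    qed
    then have repG: "rep x \<in> carrier G" if "x \<in> carrier G" for x using that by (auto simp: orb_def)
    have co: "co x \<in> A \<and> N i #> x = N i #> (co x \<otimes> rep x)" if x: "x \<in> carrier G" for x
      unfolding co_def
    proof (rule someI_ex)
      obtain c where c: "c \<in> A" "N i #> rep x = N i #> (c \<otimes> x)"
        using rep[OF x] by (auto simp: orb_def)
      then have "N i #> (inv c \<otimes> rep x) = N i #> (inv c \<otimes> (c \<otimes> x))"
        using AG x repG by - (rule N_coset_mult, auto)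
      also have "inv c \<otimes> (c \<otimes> x) = x" using c(1) AG x by (simp add: m_assoc[symmetric])
      finally show "\<exists>c. c \<in> A \<and> N i #> x = N i #> (c \<otimes> rep x)" using Ac(2) c(1) by metis
    qed
    then have coA: "co x \<in> A" and co_eq: "N i #> x = N i #> (co x \<otimes> rep x)"
      if "x \<in> carrier G" for x
      using that by blast+
    have co_rep: "co x \<otimes> rep x \<in> carrier G" if "x \<in> carrier G" for x
      using that coA AG repG by simp
    have orb_cong: "orb x = orb y"
      if "x \<in> carrier G" "y \<in> carrier G" "N i #> x = N i #> y" for x y
    proof -
      have "N i #> (c \<otimes> x) = N i #> (c \<otimes> y)" if "c \<in> A" for c
        using that \<open>N i #> x = N i #> y\<close> \<open>x \<in> _\<close> \<open>y \<in> _\<close> AG by - (rule N_coset_mult, auto)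
      then show ?thesis unfolding orb_def by auto
    qed
    have orb_mult: "orb (d \<otimes> x) = orb x" if d: "d \<in> A" and x: "x \<in> carrier G" for d x
    proof -
      have "(\<exists>c \<in> A. N i #> y = N i #> (c \<otimes> (d \<otimes> x))) \<longleftrightarrow> (\<exists>c \<in> A. N i #> y = N i #> (c \<otimes> x))" for y
      proof
        assume "\<exists>c \<in> A. N i #> y = N i #> (c \<otimes> (d \<otimes> x))"
        then obtain c where "c \<in> A" "N i #> y = N i #> (c \<otimes> (d \<otimes> x))" by blast
        then show "\<exists>c \<in> A. N i #> y = N i #> (c \<otimes> x)"
          using d x AG Ac by (intro bexI[of _ "c \<otimes> d"]) (simp_all add: m_assoc)
      next
        assume "\<exists>c \<in> A. N i #> y = N i #> (c \<otimes> x)"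
        then obtain c where c: "c \<in> A" "N i #> y = N i #> (c \<otimes> x)" by blast
        moreover have "c \<otimes> inv d \<otimes> (d \<otimes> x) = c \<otimes> x"
        proof -
          have "c \<otimes> inv d \<otimes> (d \<otimes> x) = c \<otimes> (inv d \<otimes> d) \<otimes> x"
            using c(1) d x AG by (simp only: m_assoc inv_closed m_closed)
          then show ?thesis using c(1) d x AG by simp
        qed
        ultimately show "\<exists>c \<in> A. N i #> y = N i #> (c \<otimes> (d \<otimes> x))"
          using d Ac by (intro bexI[of _ "c \<otimes> inv d"]) simp_all
      qed
      then show ?thesis by (simp add: orb_def)
    qed
    have rA': "r' x \<in> A" if "x \<in> carrier G" for x
      using that coA rA repG Ac by (simp add: r'_def)
    \<comment> \<open>Both choices depend on \<open>x\<close> only through its coset of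
      \<open>N i\<close>, so this is an equality of elements and not just a congruence.\<close>
    have r'_cong: "r' x = r' y" if "x \<in> carrier G" "y \<in> carrier G" "N i #> x = N i #> y" for x y
      using orb_cong[OF that] that(3) by (simp add: r'_def co_def rep_def)
    \<comment> \<open>The correction is invisible at the levels above i, so the compatibility
      obtained so far is inherited from the old map.\<close>
    have r'_r: "N j #> r' x = N j #> r x" if j: "j \<ge> Suc i" and x: "x \<in> carrier G" for j x
    proof -
      have "N (Suc i) #> r (co x \<otimes> rep x) = N (Suc i) #> r' x"
        using r_eq[OF coA[OF x] repG[OF x]] by (simp only: r'_def)
      then have "N j #> r (co x \<otimes> rep x) = N j #> r' x"
        by (rule N_coset_mono[OF j AG[OF rA[OF co_rep[OF x]]] AG[OF rA'[OF x]]])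
      moreover have "N j #> x = N j #> (co x \<otimes> rep x)"
        using N_coset_mono[OF _ x co_rep[OF x] co_eq[OF x]] j by simp
      then have "N j #> r x = N j #> r (co x \<otimes> rep x)"
        by (rule r_cong[OF j x co_rep[OF x]])
      ultimately show ?thesis by (simp only:)
    qed
    have r'_eq: "N i #> r' (d \<otimes> x) = N i #> (d \<otimes> r' x)" if d: "d \<in> A" and x: "x \<in> carrier G" for d x
    proof -
      have dx: "d \<otimes> x \<in> carrier G" using d x AG by simp
      have rep_eq: "rep (d \<otimes> x) = rep x" using orb_mult[OF d x] by (simp add: rep_def)
      have cc: "co x \<in> carrier G" "co (d \<otimes> x) \<in> carrier G" "r (rep x) \<in> carrier G"
        "rep x \<in> carrier G" "d \<in> carrier G"
        using coA dx x AG rA repG d by auto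
      have "N i #> (co (d \<otimes> x) \<otimes> rep x) = N i #> (d \<otimes> x)"
        using co_eq[OF dx] by (simp only: rep_eq)
      also have "\<dots> = N i #> (d \<otimes> (co x \<otimes> rep x))"
        by (rule N_coset_mult[OF cc(5) x cc(5) co_rep[OF x] HOL.refl co_eq[OF x]])
      also have "\<dots> = N i #> (d \<otimes> co x \<otimes> rep x)"
        using cc by (simp add: m_assoc)
      \<comment> \<open>Although \<open>co\<close> is an arbitrary choice, cancelling the common
        representative determines it modulo \<open>N i\<close>.\<close>
      finally have "N i #> co (d \<otimes> x) = N i #> (d \<otimes> co x)"
        by (rule N_coset_right_cancel[OF cc(2) m_closed[OF cc(5) cc(1)] cc(4)])
      then have "N i #> (co (d \<otimes> x) \<otimes> r (rep x)) = N i #> (d \<otimes> co x \<otimes> r (rep x))"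
        using cc by - (rule N_coset_mult, auto)
      then show ?thesis using cc rep_eq by (simp add: r'_def m_assoc)
    qed
    have r'_mono: "N j #> r' x = N j #> r' y"
      if "j \<ge> i" "x \<in> carrier G" "y \<in> carrier G" "N j #> x = N j #> y" for j x y
    proof (cases "j = i")
      case True
      then show ?thesis by (simp only: r'_cong[OF that(2,3) that(4)[unfolded True]])
    next
      case False
      then have j: "j \<ge> Suc i" using that(1) by simp
      show ?thesis using r_cong[OF j that(2-4)] r'_r[OF j that(2)] r'_r[OF j that(3)] by simp
    qed
    have "P i r'"
      unfolding P_def by (intro conjI ballI allI impI; rule rA' r'_eq r'_mono; assumption)
    then show ?thesis by blast
  qed
  have "\<exists>r. P n r"
  proof
    have all_eq: "N n #> x = N n #> y" if "x \<in> carrier G" "y \<in> carrier G" for x y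
      using that N_coset_eq_iff[OF that, of n] N_n by simp
    \<comment> \<open>The top term is all of \<open>G\<close>, so modulo it any two elements agree
      and a constant map starts the descent.\<close>
    show "P n (\<lambda>_. \<one>)"
      unfolding P_def by (intro conjI ballI allI impI HOL.refl Ac(3) all_eq m_closed one_closed AG)
  qed
  then have "\<exists>r. P (n - j) r" if "j \<le> n" for j
    using that
  proof (induction j)
    case (Suc j)
    then have "\<exists>r. P (Suc (n - Suc j)) r" by (simp add: Suc_diff_Suc)
    then show ?case by (rule step)
  qed simp
  from this[of n] obtain r where r: "P 0 r" by auto
  note rA = r[unfolded P_def, THEN conjunct1, rule_format]
    and r_eq = r[unfolded P_def, THEN conjunct2, THEN conjunct1, rule_format]
    and r_cong = r[unfolded P_def, THEN conjunct2, THEN conjunct2, rule_format]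
  have "r (c \<otimes> x) = c \<otimes> r x" if "c \<in> A" "x \<in> carrier G" for c x
  proof -
    have c: "r (c \<otimes> x) \<in> carrier G" "c \<otimes> r x \<in> carrier G"
      using rA that AG by auto
    have "inv (r (c \<otimes> x)) \<otimes> (c \<otimes> r x) = \<one>"
      using r_eq[OF that] N_coset_eq_iff[OF c, of 0] N_0 by simp
    then show ?thesis using c by (metis inv_closed inv_equality inv_inv)
  qed
  then show ?thesis
    by (intro exI[of _ r] conjI ballI allI impI) (assumption | rule rA r_cong le0)+
qed

end

section \<open>Permutations that twist a subgroup\<close>

locale equivariant_twist = group G for G (structure) +
  fixes A :: "'a set" and f r :: "'a \<Rightarrow> 'a"
  assumes fin: "finite (carrier G)" and A: "subgroup A G"
    and f_mult: "c \<in> A \<Longrightarrow> d \<in> A \<Longrightarrow> f (c \<otimes> d) = f c \<otimes> f d"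
    and f_bij: "bij_betw f A A"
    and r_closed: "x \<in> carrier G \<Longrightarrow> r x \<in> A"
    and r_mult: "c \<in> A \<Longrightarrow> x \<in> carrier G \<Longrightarrow> r (c \<otimes> x) = c \<otimes> r x"
begin

text \<open>Every \<open>x\<close> is \<open>r x\<close> times \<open>inv (r x) \<otimes> x\<close>,
  and by equivariance the second factor is constant on the orbit of \<open>x\<close> under
  \<open>A\<close>. The map applies \<open>f\<close> to the first factor and keeps the
  second.\<close>

definition twist :: "'a \<Rightarrow> 'a" where
  "twist = (\<lambda>x \<in> carrier G. f (r x) \<otimes> inv (r x) \<otimes> x)"

lemma A_carrier: "c \<in> A \<Longrightarrow> c \<in> carrier G"
  using A by (rule subgroup.mem_carrier)

lemma f_closed: "c \<in> A \<Longrightarrow> f c \<in> A"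
  using f_bij by (auto simp: bij_betw_def)

lemma twist_closed: "x \<in> carrier G \<Longrightarrow> twist x \<in> carrier G"
  using r_closed f_closed A_carrier by (simp add: twist_def)

lemma twist_mult:
  assumes c: "c \<in> A" and x: "x \<in> carrier G"
  shows "twist (c \<otimes> x) = f c \<otimes> twist x"
proof -
  note G = A_carrier[OF c] A_carrier[OF r_closed[OF x]] A_carrier[OF f_closed[OF c]]
    A_carrier[OF f_closed[OF r_closed[OF x]]] x
  have "inv c \<otimes> (c \<otimes> x) = x" using G by (simp add: m_assoc[symmetric])
  then show ?thesis
    using G c r_closed[OF x] by (simp add: twist_def r_mult f_mult inv_mult_group m_assoc)
qed

text \<open>The factor put in front of \<open>x\<close> lies in \<open>A\<close>, so equivariance
  takes it out of \<open>r\<close>. The image thus determines \<open>r x\<close> and then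
  \<open>x\<close>, which is how injectivity follows.\<close>

lemma r_twist:
  assumes x: "x \<in> carrier G" shows "r (twist x) = f (r x)"
proof -
  note G = A_carrier[OF r_closed[OF x]] A_carrier[OF f_closed[OF r_closed[OF x]]] x
  have "f (r x) \<otimes> inv (r x) \<in> A"
    using A r_closed[OF x] f_closed by (simp add: subgroup.m_closed subgroup.m_inv_closed)
  then have "r (twist x) = f (r x) \<otimes> inv (r x) \<otimes> r x"
    using x by (simp add: twist_def r_mult)
  then show ?thesis using G by (simp add: m_assoc)
qed

lemma twist_Bij: "twist \<in> Bij (carrier G)"
proof -
  have "inj_on twist (carrier G)"
  proof (rule inj_onI)
    fix x y assume x: "x \<in> carrier G" and y: "y \<in> carrier G" and eq: "twist x = twist y"
    have "f (r x) = f (r y)" using r_twist x y eq by metis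
    then have "r x = r y" using f_bij r_closed x y by (auto simp: bij_betw_def inj_on_def)
    then show "x = y"
      using eq x y A_carrier[OF r_closed[OF y]] A_carrier[OF f_closed[OF r_closed[OF y]]]
      by (simp add: twist_def)
  qed
  moreover have "twist ` carrier G = carrier G"
    using twist_closed calculation by (intro endo_inj_surj fin) auto
  ultimately show ?thesis by (simp add: Bij_def bij_betw_def twist_def)
qed

end

section \<open>Shears\<close>

definition exponent_sign :: "bool \<Rightarrow> int" where
  "exponent_sign e = (if e then 1 else -1)"

text \<open>This is the matrix 1 + c M, where M moves entry j - 1 to place j wherever the label of j
  is \<open>s\<close>. At j = 0 the truncated predecessor would be 0 itself;
  \<open>alternating_labels\<close> excludes this by leaving 0 unlabelled.\<close>

definition shear :: "(nat \<Rightarrow> 's option) \<Rightarrow> int \<Rightarrow> 's \<Rightarrow> (nat \<Rightarrow> int) \<Rightarrow> nat \<Rightarrow> int" where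
  "shear lab c s v j = v j + (if lab j = Some s then c * v (j - 1) else 0)"

text \<open>The entries are computed over the integers, since the modulus is chosen only afterwards,
  from the size of the result. The head of the list acts last, as in a product of
  permutations.\<close>

fun shear_word :: "(nat \<Rightarrow> 's option) \<Rightarrow> ('s \<times> bool) list \<Rightarrow> nat \<Rightarrow> int" where
  "shear_word lab [] = (\<lambda>j. if j = 0 then 1 else 0)"
| "shear_word lab ((s, e) # L) = shear lab (exponent_sign e) s (shear_word lab L)"

fun freely_reduced :: "('s \<times> bool) list \<Rightarrow> bool" where
  "freely_reduced ((s, e) # (s', e') # L) \<longleftrightarrow> (s = s' \<longrightarrow> e = e') \<and> freely_reduced ((s', e') # L)"
| "freely_reduced _ \<longleftrightarrow> True"

lemma freely_reduced_tl: "freely_reduced (x # L) \<Longrightarrow> freely_reduced L"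
  by (cases x; cases L) auto

text \<open>
  Since no two consecutive labels agree, the nilpotent part of each shear has square zero.
\<close>

definition alternating_labels :: "(nat \<Rightarrow> 's option) \<Rightarrow> nat \<Rightarrow> bool" where
  "alternating_labels lab r \<longleftrightarrow>
     lab 0 = None \<and> (\<forall>j > r. lab j = None) \<and> (\<forall>j. lab j \<noteq> None \<longrightarrow> lab j \<noteq> lab (Suc j))"

text \<open>
  The labels are the letters of the word in the order in which they act, one for each run of
  equal letters; a run of length \<open>m\<close> multiplies the leading entry by \<open>m\<close> up to sign. The
  labels beyond \<open>r\<close> are left open in \<open>lab'\<close>, so that a further run can be appended.
\<close>

lemma ex_shear_labels_aux:
  assumes "freely_reduced L"
  shows "\<exists>r lab. alternating_labels lab r \<and> (r = 0 \<longleftrightarrow> L = []) \<and>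
     (L \<noteq> [] \<longrightarrow> lab r = Some (fst (hd L))) \<and>
     (\<forall>lab'. (\<forall>j \<le> r. lab' j = lab j) \<longrightarrow> lab' (Suc r) = None \<or> lab' (Suc r) \<noteq> lab r \<longrightarrow>
        (\<forall>j > r. shear_word lab' L j = 0) \<and> shear_word lab' L r \<noteq> 0 \<and>
        (L \<noteq> [] \<longrightarrow> shear_word lab' L (r - 1) \<noteq> 0 \<and>
           (\<exists>m > 0. shear_word lab' L r = exponent_sign (snd (hd L)) * m * shear_word lab' L (r - 1))))"
  using assms
proof (induction L)
  case Nil
  show ?case
    by (rule exI[of _ 0], rule exI[of _ "\<lambda>_. None"]) (auto simp: alternating_labels_def)
next
  case (Cons x L)
  obtain s e where x: "x = (s, e)" by (cases x)
  have red: "freely_reduced L" using Cons.prems by (rule freely_reduced_tl)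
  obtain r lab where alt: "alternating_labels lab r" and r0: "r = 0 \<longleftrightarrow> L = []"
    and top: "L \<noteq> [] \<Longrightarrow> lab r = Some (fst (hd L))"
    and IH: "\<And>lab'. \<forall>j \<le> r. lab' j = lab j \<Longrightarrow> lab' (Suc r) = None \<or> lab' (Suc r) \<noteq> lab r \<Longrightarrow>
        (\<forall>j > r. shear_word lab' L j = 0) \<and> shear_word lab' L r \<noteq> 0 \<and>
        (L \<noteq> [] \<longrightarrow> shear_word lab' L (r - 1) \<noteq> 0 \<and>
           (\<exists>m > 0. shear_word lab' L r = exponent_sign (snd (hd L)) * m * shear_word lab' L (r - 1)))"
    using Cons.IH[OF red] by blast
  show ?case
  \<comment> \<open>Either the new letter prolongs the run that acted last, whose multiplicity m
    grows by one, or it opens a new run, which receives the fresh label at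
    \<open>Suc r\<close>.\<close>
  proof (cases "lab r = Some s")
    case True
    then have L: "L \<noteq> []" "r > 0" using alt r0 by (auto simp: alternating_labels_def)
    then have hd: "fst (hd L) = s" using top True by simp
    \<comment> \<open>A reduced word has equal signs within a run, so the multiplicity cannot
      cancel.\<close>
    have e: "snd (hd L) = e" using Cons.prems L(1) hd x by (cases L) auto
    \<comment> \<open>Hence the new letter leaves entry r - 1 alone, and this entry stays the
      reference with which entry r is compared.\<close>
    have rm1: "lab (r - 1) \<noteq> Some s"
    proof
      assume "lab (r - 1) = Some s"
      then show False using alt True L(2) unfolding alternating_labels_def by (metis Suc_pred' option.distinct(1))
    qed
    show ?thesis
    proof (rule exI[of _ r], rule exI[of _ lab], intro conjI allI impI)
      fix lab' assume l: "\<forall>j \<le> r. lab' j = lab j" "lab' (Suc r) = None \<or> lab' (Suc r) \<noteq> lab r"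
      let ?v = "shear_word lab' L"
      obtain m where z: "\<forall>j > r. ?v j = 0" and nz: "?v (r - 1) \<noteq> 0"
        and m: "m > 0" "?v r = exponent_sign e * m * ?v (r - 1)"
        using IH[OF l] L(1) e by blast
      have v: "shear_word lab' (x # L) j = ?v j + (if lab' j = Some s then exponent_sign e * ?v (j - 1) else 0)" for j
        by (simp add: x shear_def)
      have v1: "shear_word lab' (x # L) (r - 1) = ?v (r - 1)" using l(1) rm1 v by simp
      then show "shear_word lab' (x # L) (r - 1) \<noteq> 0" using nz by simp
      have vr: "shear_word lab' (x # L) r = exponent_sign e * (m + 1) * ?v (r - 1)"
        using m(2) l(1) True v by (simp add: algebra_simps)
      then show "shear_word lab' (x # L) r \<noteq> 0" using nz m(1) by (simp add: exponent_sign_def)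
      show "\<exists>m > 0. shear_word lab' (x # L) r = exponent_sign (snd (hd (x # L))) * m * shear_word lab' (x # L) (r - 1)"
        using vr v1 m(1) x by (intro exI[of _ "m + 1"]) simp
      fix j assume j: "j > r"
      show "shear_word lab' (x # L) j = 0"
      proof (cases "j = Suc r")
        case True
        then have "lab' j \<noteq> Some s" using l(2) \<open>lab r = Some s\<close> by auto
        then show ?thesis using v z j by simp
      next
        case False
        then have "j - 1 > r" using j by simp
        then show ?thesis using v z j by simp
      qed
    qed (use alt L True x in auto)
  next
    case False
    define lab2 where "lab2 = lab(Suc r := Some s)"
    have alt2: "alternating_labels lab2 (Suc r)"
      using alt False by (auto simp: alternating_labels_def lab2_def)
    show ?thesis
    proof (rule exI[of _ "Suc r"], rule exI[of _ lab2], intro conjI allI impI)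
      show "alternating_labels lab2 (Suc r)" by (rule alt2)
      fix lab' assume l: "\<forall>j \<le> Suc r. lab' j = lab2 j"
        "lab' (Suc (Suc r)) = None \<or> lab' (Suc (Suc r)) \<noteq> lab2 (Suc r)"
      let ?v = "shear_word lab' L"
      \<comment> \<open>The label at \<open>Suc r\<close> is now \<open>s\<close>, which differs
        from \<open>lab r\<close>; this is the alternative that the induction hypothesis leaves
        open.\<close>
      have l': "\<forall>j \<le> r. lab' j = lab j" "lab' (Suc r) = None \<or> lab' (Suc r) \<noteq> lab r"
        using l(1) False by (auto simp: lab2_def)
      have z: "\<forall>j > r. ?v j = 0" and nz: "?v r \<noteq> 0" using IH[OF l'] by auto
      have v: "shear_word lab' (x # L) j = ?v j + (if lab' j = Some s then exponent_sign e * ?v (j - 1) else 0)" for j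
        by (simp add: x shear_def)
      have v1: "shear_word lab' (x # L) r = ?v r" using l'(1) False v by simp
      then show "shear_word lab' (x # L) (Suc r - 1) \<noteq> 0" using nz by simp
      have vr: "shear_word lab' (x # L) (Suc r) = exponent_sign e * ?v r"
        using l(1) z v by (simp add: lab2_def)
      then show "shear_word lab' (x # L) (Suc r) \<noteq> 0" using nz by (simp add: exponent_sign_def)
      show "\<exists>m > 0. shear_word lab' (x # L) (Suc r) = exponent_sign (snd (hd (x # L))) * m * shear_word lab' (x # L) (Suc r - 1)"
        using vr v1 x by (intro exI[of _ "1::int"]) simp
      fix j assume j: "j > Suc r"
      show "shear_word lab' (x # L) j = 0"
        using v z j by simp
    qed (use x in \<open>auto simp: lab2_def\<close>)
  qed
qed

lemma ex_shear_labels: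
  assumes "freely_reduced L" "L \<noteq> []"
  shows "\<exists>r lab. alternating_labels lab r \<and> r > 0 \<and> shear_word lab L r \<noteq> 0"
proof -
  obtain r lab where rl: "alternating_labels lab r" "r = 0 \<longleftrightarrow> L = []"
    and "\<forall>lab'. (\<forall>j \<le> r. lab' j = lab j) \<longrightarrow> lab' (Suc r) = None \<or> lab' (Suc r) \<noteq> lab r \<longrightarrow>
       shear_word lab' L r \<noteq> 0"
    using ex_shear_labels_aux[OF assms(1)] by blast
  moreover have "lab (Suc r) = None" using rl(1) by (simp add: alternating_labels_def)
  ultimately show ?thesis using assms(2) by blast
qed

section \<open>Vectors modulo q, their filtration, and shears modulo q\<close>

definition vec_group :: "nat \<Rightarrow> nat \<Rightarrow> (nat \<Rightarrow> int) monoid" where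
  "vec_group q R =
     \<lparr>carrier = {v. (\<forall>j. 0 \<le> v j \<and> v j < int q) \<and> (\<forall>j > R. v j = 0)},
      monoid.mult = (\<lambda>u v j. (u j + v j) mod int q), one = (\<lambda>_. 0)\<rparr>"

lemma carrier_vec_group:
  "v \<in> carrier (vec_group q R) \<longleftrightarrow> (\<forall>j. 0 \<le> v j \<and> v j < int q) \<and> (\<forall>j > R. v j = 0)"
  by (simp add: vec_group_def)

lemma mult_vec_group: "u \<otimes>\<^bsub>vec_group q R\<^esub> v = (\<lambda>j. (u j + v j) mod int q)"
  by (simp add: vec_group_def)

lemma one_vec_group: "\<one>\<^bsub>vec_group q R\<^esub> = (\<lambda>_. 0)"
  by (simp add: vec_group_def)

lemma comm_group_vec_group:
  assumes q: "q > 0" shows "comm_group (vec_group q R)"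
proof (rule comm_groupI)
  fix u assume u: "u \<in> carrier (vec_group q R)"
  show "\<exists>v\<in>carrier (vec_group q R). v \<otimes>\<^bsub>vec_group q R\<^esub> u = \<one>\<^bsub>vec_group q R\<^esub>"
    using u q by (intro bexI[of _ "\<lambda>j. (- u j) mod int q"])
      (auto simp: carrier_vec_group mult_vec_group one_vec_group mod_add_left_eq)
  show "\<one>\<^bsub>vec_group q R\<^esub> \<otimes>\<^bsub>vec_group q R\<^esub> u = u"
    using u q by (auto simp: carrier_vec_group mult_vec_group one_vec_group)
next
  fix u v w :: "nat \<Rightarrow> int"
  show "u \<otimes>\<^bsub>vec_group q R\<^esub> v \<otimes>\<^bsub>vec_group q R\<^esub> w = u \<otimes>\<^bsub>vec_group q R\<^esub> (v \<otimes>\<^bsub>vec_group q R\<^esub> w)"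
    by (simp add: mult_vec_group mod_simps add.assoc)
qed (use q in \<open>auto simp: carrier_vec_group mult_vec_group one_vec_group add.commute\<close>)

lemma inv_vec_group:
  assumes q: "q > 0" and u: "u \<in> carrier (vec_group q R)"
  shows "inv\<^bsub>vec_group q R\<^esub> u = (\<lambda>j. (- u j) mod int q)"
  by (rule group.inv_equality[OF comm_group.axioms(2)[OF comm_group_vec_group[OF q]]])
    (use u q in \<open>auto simp: carrier_vec_group mult_vec_group one_vec_group mod_add_left_eq\<close>)

lemma pow_vec_group: "q > 0 \<Longrightarrow> (v [^]\<^bsub>vec_group q R\<^esub> (m::nat)) j = (int m * v j) mod int q"
  by (induction m) (auto simp: mult_vec_group one_vec_group nat_pow_0 nat_pow_Suc mod_simps algebra_simps)

lemma finite_vec_group: "finite (carrier (vec_group q R))"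
proof (rule finite_surj)
  show "finite ({..R} \<rightarrow>\<^sub>E {0..<int q})" by (simp add: finite_PiE)
  show "carrier (vec_group q R) \<subseteq> (\<lambda>f j. if j \<le> R then f j else 0) ` ({..R} \<rightarrow>\<^sub>E {0..<int q})"
  proof
    fix v assume v: "v \<in> carrier (vec_group q R)"
    then have "v = (\<lambda>j. if j \<le> R then restrict v {..R} j else 0)"
      by (auto simp: carrier_vec_group)
    moreover have "restrict v {..R} \<in> {..R} \<rightarrow>\<^sub>E {0..<int q}"
      using v by (auto simp: carrier_vec_group)
    ultimately show "v \<in> (\<lambda>f j. if j \<le> R then f j else 0) ` ({..R} \<rightarrow>\<^sub>E {0..<int q})" by blast
  qed
qed

text \<open>Only the last i of the entries 0, ..., R may be non-zero, so the terms grow from zero to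
  everything in R + 1 steps. Writing j + i on the left avoids the truncated R - i, which for i > R
  would still force entry 0 to vanish.\<close>

definition vec_sub :: "nat \<Rightarrow> nat \<Rightarrow> nat \<Rightarrow> (nat \<Rightarrow> int) set" where
  "vec_sub q R i = {v \<in> carrier (vec_group q R). \<forall>j. j + i \<le> R \<longrightarrow> v j = 0}"

lemma normal_vec_sub:
  assumes q: "q > 0" shows "vec_sub q R i \<lhd> vec_group q R"
proof -
  interpret V: comm_group "vec_group q R" using q by (rule comm_group_vec_group)
  have "subgroup (vec_sub q R i) (vec_group q R)"
  proof (rule V.subgroupI)
    have "\<one>\<^bsub>vec_group q R\<^esub> \<in> vec_sub q R i"
      unfolding vec_sub_def using V.one_closed by (simp add: one_vec_group)
    then show "vec_sub q R i \<noteq> {}" by blast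
    show "inv\<^bsub>vec_group q R\<^esub> u \<in> vec_sub q R i" if "u \<in> vec_sub q R i" for u
      using that V.inv_closed[of u] inv_vec_group[OF q, of u R] by (auto simp: vec_sub_def)
    show "u \<otimes>\<^bsub>vec_group q R\<^esub> v \<in> vec_sub q R i" if "u \<in> vec_sub q R i" "v \<in> vec_sub q R i" for u v
      using that V.m_closed[of u v] by (auto simp: vec_sub_def mult_vec_group)
  qed (auto simp: vec_sub_def)
  then show ?thesis by (rule V.subgroup_imp_normal)
qed

lemma vec_sub_diff_iff:
  assumes q: "q > 0" and u: "u \<in> carrier (vec_group q R)" and v: "v \<in> carrier (vec_group q R)"
  shows "inv\<^bsub>vec_group q R\<^esub> u \<otimes>\<^bsub>vec_group q R\<^esub> v \<in> vec_sub q R i \<longleftrightarrow> (\<forall>j. j + i \<le> R \<longrightarrow> u j = v j)"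
proof -
  interpret V: comm_group "vec_group q R" using q by (rule comm_group_vec_group)
  have "(inv\<^bsub>vec_group q R\<^esub> u \<otimes>\<^bsub>vec_group q R\<^esub> v) j = (v j - u j) mod int q" for j
    by (simp add: inv_vec_group[OF q u] mult_vec_group mod_simps)
  moreover have "(v j - u j) mod int q = 0 \<longleftrightarrow> u j = v j" for j
    using mod_eq_dvd_iff[of "v j" "int q" "u j"] u v by (auto simp: carrier_vec_group dvd_eq_mod_eq_0)
  ultimately show ?thesis using u v by (simp add: vec_sub_def)
qed

definition mod_shear :: "nat \<Rightarrow> (nat \<Rightarrow> 's option) \<Rightarrow> int \<Rightarrow> 's \<Rightarrow> (nat \<Rightarrow> int) \<Rightarrow> nat \<Rightarrow> int" where
  "mod_shear q lab c s v j = shear lab c s v j mod int q"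

lemma mod_shear_closed:
  assumes "q > 0" "alternating_labels lab R" "v \<in> carrier (vec_group q R)"
  shows "mod_shear q lab c s v \<in> carrier (vec_group q R)"
  using assms by (auto simp: carrier_vec_group mod_shear_def shear_def alternating_labels_def)

text \<open>The matrix M of the shear has square zero, so 1 - c M inverts 1 + c M. Concretely, entry
  j - 1 is unchanged whenever entry j is changed.\<close>

lemma mod_shear_cancel:
  assumes q: "q > 0" and alt: "alternating_labels lab R" and v: "v \<in> carrier (vec_group q R)"
  shows "mod_shear q lab (- c) s (mod_shear q lab c s v) = v"
proof
  fix j
  show "mod_shear q lab (- c) s (mod_shear q lab c s v) j = v j"
  proof (cases "lab j = Some s")
    case True
    then have "j > 0" "lab (j - 1) \<noteq> Some s"
      using alt unfolding alternating_labels_def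
      by (metis gr0I option.distinct(1)) (metis True alt alternating_labels_def Suc_pred' gr0I option.distinct(1))
    then show ?thesis
      using True v by (simp add: mod_shear_def shear_def mod_simps carrier_vec_group algebra_simps)
  next
    case False
    then show ?thesis using v by (simp add: mod_shear_def shear_def carrier_vec_group)
  qed
qed

lemma mod_shear_mod: "mod_shear q lab c s (\<lambda>j. v j mod int q) = (\<lambda>j. shear lab c s v j mod int q)"
proof
  fix j
  have "(v j mod int q + c * (v (j - 1) mod int q)) mod int q = (v j + c * v (j - 1)) mod int q"
    by (intro mod_add_cong mod_mult_cong) auto
  then show "mod_shear q lab c s (\<lambda>j. v j mod int q) j = shear lab c s v j mod int q"
    by (simp add: mod_shear_def shear_def)
qed

text \<open>This is the unitriangular condition for a shear. What it adds at entry j comes from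
  entry j - 1, and there \<open>u\<close> and \<open>v\<close> already agree, because the difference
  is controlled one entry less far at level \<open>Suc i\<close>.\<close>

lemma vec_sub_mod_shear:
  assumes q: "q > 0" and alt: "alternating_labels lab R"
    and u: "u \<in> carrier (vec_group q R)" and v: "v \<in> carrier (vec_group q R)"
    and d: "inv\<^bsub>vec_group q R\<^esub> u \<otimes>\<^bsub>vec_group q R\<^esub> v \<in> vec_sub q R (Suc i)"
  shows "inv\<^bsub>vec_group q R\<^esub> (inv\<^bsub>vec_group q R\<^esub> mod_shear q lab c s u \<otimes>\<^bsub>vec_group q R\<^esub> mod_shear q lab c s v)
    \<otimes>\<^bsub>vec_group q R\<^esub> (inv\<^bsub>vec_group q R\<^esub> u \<otimes>\<^bsub>vec_group q R\<^esub> v) \<in> vec_sub q R i"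
proof -
  interpret V: comm_group "vec_group q R" using q by (rule comm_group_vec_group)
  have c: "mod_shear q lab c s u \<in> carrier (vec_group q R)" "mod_shear q lab c s v \<in> carrier (vec_group q R)"
    using mod_shear_closed[OF q alt] u v by auto
  have eq: "u j = v j" if "j + Suc i \<le> R" for j
    using d that by (simp add: vec_sub_diff_iff[OF q u v])
  have "(inv\<^bsub>vec_group q R\<^esub> mod_shear q lab c s u \<otimes>\<^bsub>vec_group q R\<^esub> mod_shear q lab c s v) j
      = (inv\<^bsub>vec_group q R\<^esub> u \<otimes>\<^bsub>vec_group q R\<^esub> v) j" if j: "j + i \<le> R" for j
  proof (cases "lab j = Some s")
    case True
    then have "j > 0" using alt by (auto simp: alternating_labels_def intro: gr0I)
    then have "u (j - 1) = v (j - 1)" using eq j by simp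
    then show ?thesis using True
      by (simp add: inv_vec_group[OF q] u c mult_vec_group mod_shear_def shear_def mod_simps)
  next
    case False
    then show ?thesis
      by (simp add: inv_vec_group[OF q] u c mult_vec_group mod_shear_def shear_def mod_simps)
  qed
  then show ?thesis using u v c by (simp add: vec_sub_diff_iff[OF q])
qed

section \<open>Normal forms in the HNN-extension\<close>

context equivariant_twist
begin

lemma f_one: "f \<one> = \<one>"
proof -
  have "\<one> \<in> A" using A by (rule subgroup.one_closed)
  then have "f \<one> \<otimes> f \<one> = f \<one>" using f_mult[of \<one> \<one>] by simp
  then show ?thesis using \<open>\<one> \<in> A\<close> f_closed A_carrier by (metis l_cancel_one')
qed

lemma f_inv:
  assumes c: "c \<in> A" shows "f (inv c) = inv (f c)"
proof -
  have ci: "inv c \<in> A" using A c by (rule subgroup.m_inv_closed)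
  have "f (inv c) \<otimes> f c = \<one>" using f_mult[OF ci c] f_one A_carrier[OF c] by simp
  then show ?thesis using c ci f_closed A_carrier by (metis inv_equality)
qed

lemma f_nat_pow:
  assumes c: "c \<in> A" shows "c [^] (m::nat) \<in> A \<and> f (c [^] m) = f c [^] m"
proof (induction m)
  case 0
  then show ?case using f_one subgroup.one_closed[OF A] by simp
next
  case (Suc m)
  then show ?case using c f_mult subgroup.m_closed[OF A] by simp
qed

lemma f_int_pow:
  assumes c: "c \<in> A" shows "c [^] (m::int) \<in> A" "f (c [^] m) = f c [^] m"
proof -
  have "c [^] m \<in> A \<and> f (c [^] m) = f c [^] m"
  proof (cases "m \<ge> 0")
    case True
    then obtain n where "m = int n" using nonneg_int_cases by blast
    then show ?thesis using f_nat_pow[OF c] by (simp add: int_pow_int)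
  next
    case False
    then obtain n where n: "m = - int n" by (metis int_cases4 minus_minus nle_le of_nat_0_le_iff)
    have "c [^] m = inv (c [^] n)" "f c [^] m = inv (f c [^] n)"
      using n c f_closed A_carrier by (simp_all add: int_pow_neg int_pow_int)
    then show ?thesis
      using f_nat_pow[OF c, of n] f_inv[of "c [^] n"] subgroup.m_inv_closed[OF A] by simp
  qed
  then show "c [^] m \<in> A" "f (c [^] m) = f c [^] m" by auto
qed

lemma coset_A_eqD:
  assumes "x \<in> carrier G" "y \<in> carrier G" "A #> x = A #> y"
  shows "\<exists>c \<in> A. y = c \<otimes> x"
proof -
  have "y \<in> A #> x" using rcos_self[OF assms(2) A] assms(3) by simp
  then show ?thesis by (auto simp: r_coset_def)
qed

lemma coset_A_mult:
  assumes "c \<in> A" "x \<in> carrier G"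
  shows "A #> (c \<otimes> x) = A #> x"
proof -
  have "c \<otimes> x \<in> A #> x" using assms(1) by (auto simp: r_coset_def)
  then show ?thesis using repr_independence[OF _ assms(2) A] by simp
qed

definition untwist :: "'a \<Rightarrow> 'a" where
  "untwist = inv_into (carrier G) twist"

lemma untwist:
  assumes "x \<in> carrier G"
  shows "untwist x \<in> carrier G" "twist (untwist x) = x" "untwist (twist x) = x"
  using assms twist_Bij unfolding untwist_def
  by (auto simp: Bij_def bij_betw_def inv_into_into f_inv_into_f)

end

locale hnn_twist = equivariant_twist G A f r for G (structure) and A f r +
  fixes a
  assumes a_in: "a \<in> carrier G" and A_gen: "A = generate G {a}"
begin

lemma a_in_A: "a \<in> A"
  unfolding A_gen by (rule generate.incl) simp

sublocale hnn_base G a "f a"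
  by unfold_locales (use a_in a_in_A f_closed A_carrier in auto)

abbreviation "H \<equiv> HNN G a (f a)"

sublocale H: group H by (rule group_HNN)

definition base :: "'a \<Rightarrow> 'a hnn_letter list set" where
  "base g = cls [Base g]"

definition stable :: "bool \<Rightarrow> 'a hnn_letter list set" where
  "stable e = cls [if e then Stable else Stable_inv]"

lemma base_closed [simp]: "g \<in> carrier G \<Longrightarrow> base g \<in> carrier H"
  by (auto simp: base_def carrier_HNN)

lemma stable_closed [simp]: "stable e \<in> carrier H"
  by (auto simp: stable_def carrier_HNN)

lemma base_mult: "g \<in> carrier G \<Longrightarrow> h \<in> carrier G \<Longrightarrow> base (g \<otimes> h) = base g \<otimes>\<^bsub>H\<^esub> base h"
  using hom_mult[OF base_hom] by (simp add: base_def)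

sublocale base: group_hom G H base
  by unfold_locales (auto simp: hom_def base_mult)

lemma stable_not: "stable (\<not> e) \<otimes>\<^bsub>H\<^esub> stable e = \<one>\<^bsub>H\<^esub>"
  by (cases e) (auto simp: stable_def mult_HNN one_HNN cls_eq_iff intro: hnn_cong.intros)

lemma stable_inv: "inv\<^bsub>H\<^esub> stable e = stable (\<not> e)"
  by (rule H.inv_equality[OF stable_not]) auto

lemma stable_conj_a: "base a \<otimes>\<^bsub>H\<^esub> stable True = stable True \<otimes>\<^bsub>H\<^esub> base (f a)"
proof -
  have "cls [Stable_inv, Base a, Stable] = cls [Base (f a)]"
    by (subst cls_eq_iff) (auto intro: hnn_cong.conj)
  then have "stable False \<otimes>\<^bsub>H\<^esub> (base a \<otimes>\<^bsub>H\<^esub> stable True) = base (f a)"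
    by (simp add: stable_def base_def mult_HNN)
  then have "base (f a) = inv\<^bsub>H\<^esub> stable True \<otimes>\<^bsub>H\<^esub> (base a \<otimes>\<^bsub>H\<^esub> stable True)"
    by (simp add: stable_inv)
  then show ?thesis by (subst (asm) H.inv_solve_left) auto
qed

lemma stable_conj_A:
  assumes "c \<in> A"
  shows "base c \<otimes>\<^bsub>H\<^esub> stable True = stable True \<otimes>\<^bsub>H\<^esub> base (f c)"
  using assms unfolding A_gen
proof (induction rule: generate.induct)
  case one
  then show ?case by (simp add: f_one base.hom_one)
next
  case (incl h)
  then show ?case using stable_conj_a by simp
next
  case (inv h)
  then have h: "h = a" by simp
  have "base a \<otimes>\<^bsub>H\<^esub> (stable True \<otimes>\<^bsub>H\<^esub> inv\<^bsub>H\<^esub> base (f a))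
      = stable True \<otimes>\<^bsub>H\<^esub> base (f a) \<otimes>\<^bsub>H\<^esub> inv\<^bsub>H\<^esub> base (f a)"
    by (simp add: stable_conj_a[symmetric] H.m_assoc)
  also have "\<dots> = stable True" by (simp add: H.m_assoc)
  finally have "stable True \<otimes>\<^bsub>H\<^esub> inv\<^bsub>H\<^esub> base (f a) = inv\<^bsub>H\<^esub> base a \<otimes>\<^bsub>H\<^esub> stable True"
    by (simp add: H.inv_solve_left)
  then show ?case using f_inv[OF a_in_A] by (simp add: h base.hom_inv)
next
  case (eng h1 h2)
  then have c: "h1 \<in> A" "h2 \<in> A" by (auto simp: A_gen)
  note G = A_carrier[OF c(1)] A_carrier[OF c(2)] A_carrier[OF f_closed[OF c(1)]] A_carrier[OF f_closed[OF c(2)]]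
  have "base (h1 \<otimes> h2) \<otimes>\<^bsub>H\<^esub> stable True = base h1 \<otimes>\<^bsub>H\<^esub> (base h2 \<otimes>\<^bsub>H\<^esub> stable True)"
    using G by (simp add: base_mult H.m_assoc)
  also have "\<dots> = base h1 \<otimes>\<^bsub>H\<^esub> stable True \<otimes>\<^bsub>H\<^esub> base (f h2)"
    unfolding eng.IH(2) using G by (simp add: H.m_assoc)
  also have "\<dots> = stable True \<otimes>\<^bsub>H\<^esub> base (f h1) \<otimes>\<^bsub>H\<^esub> base (f h2)"
    by (simp only: eng.IH(1))
  also have "\<dots> = stable True \<otimes>\<^bsub>H\<^esub> (base (f h1) \<otimes>\<^bsub>H\<^esub> base (f h2))"
    using G by (simp add: H.m_assoc)
  finally show ?case using G c by (simp add: base_mult f_mult)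
qed

lemma stable_pinch:
  assumes c: "c \<in> A"
  shows "\<exists>d \<in> A. stable e \<otimes>\<^bsub>H\<^esub> (base c \<otimes>\<^bsub>H\<^esub> stable (\<not> e)) = base d"
proof (cases e)
  case False
  have "stable False \<otimes>\<^bsub>H\<^esub> (stable True \<otimes>\<^bsub>H\<^esub> base (f c)) = base (f c)"
    using stable_not[of True] f_closed[OF c] A_carrier by (simp add: H.m_assoc[symmetric])
  then show ?thesis using False stable_conj_A[OF c] f_closed[OF c] by auto
next
  case True
  \<comment> \<open>For a pinch t c t^-1 the relation is read backwards, so \<open>c\<close> has to
    be a value of \<open>f\<close>.\<close>
  obtain d where d: "d \<in> A" "f d = c" using f_bij c by (metis bij_betw_def imageE)
  have "stable True \<otimes>\<^bsub>H\<^esub> (base c \<otimes>\<^bsub>H\<^esub> stable False)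
      = stable True \<otimes>\<^bsub>H\<^esub> base (f d) \<otimes>\<^bsub>H\<^esub> stable False"
    using d c A_carrier by (simp add: H.m_assoc)
  also have "\<dots> = base d \<otimes>\<^bsub>H\<^esub> stable True \<otimes>\<^bsub>H\<^esub> stable False"
    using stable_conj_A[OF d(1)] by simp
  also have "\<dots> = base d"
    using stable_not[of False] d A_carrier by (simp add: H.m_assoc)
  finally show ?thesis using True d(1) by auto
qed

section \<open>Reduced forms of elements\<close>

fun normal_form :: "'a \<Rightarrow> (bool \<times> 'a) list \<Rightarrow> 'a hnn_letter list set" where
  "normal_form g [] = base g"
| "normal_form g ((e, h) # l) = base g \<otimes>\<^bsub>H\<^esub> (stable e \<otimes>\<^bsub>H\<^esub> normal_form h l)"

text \<open>Both associated subgroups equal \<open>A\<close>, so one test on the middle syllable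
  serves both kinds of pinch. Syllables range over all of \<open>G\<close> and not over coset
  representatives, so an element may have several reduced forms.\<close>

fun britton_reduced :: "(bool \<times> 'a) list \<Rightarrow> bool" where
  "britton_reduced ((e, h) # (e', h') # l) \<longleftrightarrow>
     (e \<noteq> e' \<longrightarrow> h \<notin> A) \<and> britton_reduced ((e', h') # l)"
| "britton_reduced _ \<longleftrightarrow> True"

lemma normal_form_closed:
  "g \<in> carrier G \<Longrightarrow> snd ` set l \<subseteq> carrier G \<Longrightarrow> normal_form g l \<in> carrier H"
  by (induction g l rule: normal_form.induct) auto

lemma base_mult_normal_form:
  "g \<in> carrier G \<Longrightarrow> h \<in> carrier G \<Longrightarrow> snd ` set l \<subseteq> carrier G \<Longrightarrow>
     base h \<otimes>\<^bsub>H\<^esub> normal_form g l = normal_form (h \<otimes> g) l"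
  by (cases "(g, l)" rule: normal_form.cases) (auto simp: base_mult H.m_assoc normal_form_closed)

lemma britton_reduced_tl: "britton_reduced (x # l) \<Longrightarrow> britton_reduced l"
  by (cases x; cases l) auto

text \<open>A pinch at the front collapses to an element of \<open>A\<close>, which is absorbed by
  the next syllable; what remains is a tail of a reduced word. Without a pinch the letter can simply
  be put in front.\<close>

lemma stable_mult_normal_form:
  assumes g: "g \<in> carrier G" and l: "snd ` set l \<subseteq> carrier G" "britton_reduced l"
  shows "\<exists>g' l'. g' \<in> carrier G \<and> snd ` set l' \<subseteq> carrier G \<and> britton_reduced l' \<and>
    stable e \<otimes>\<^bsub>H\<^esub> normal_form g l = normal_form g' l'"
proof (cases "g \<in> A \<and> (\<exists>h l'. l = (\<not> e, h) # l')")
  case True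
  then obtain h l' where h: "g \<in> A" "l = (\<not> e, h) # l'" by blast
  obtain d where d: "d \<in> A" "stable e \<otimes>\<^bsub>H\<^esub> (base g \<otimes>\<^bsub>H\<^esub> stable (\<not> e)) = base d"
    using stable_pinch[OF h(1)] by blast
  have c: "h \<in> carrier G" "snd ` set l' \<subseteq> carrier G" "d \<in> carrier G" using l h d A_carrier by auto
  have "stable e \<otimes>\<^bsub>H\<^esub> normal_form g l =
      stable e \<otimes>\<^bsub>H\<^esub> (base g \<otimes>\<^bsub>H\<^esub> stable (\<not> e)) \<otimes>\<^bsub>H\<^esub> normal_form h l'"
    using c g h by (simp add: H.m_assoc normal_form_closed)
  also have "\<dots> = normal_form (d \<otimes> h) l'"
    using c d base_mult_normal_form by simp
  finally show ?thesis
    using c h(2) l britton_reduced_tl[of "(\<not> e, h)" l']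
    by (intro exI[of _ "d \<otimes> h"] exI[of _ l']) auto
next
  case False
  have "britton_reduced ((e, g) # l)"
    using False l(2) by (cases l) auto
  moreover have "stable e \<otimes>\<^bsub>H\<^esub> normal_form g l = normal_form \<one> ((e, g) # l)"
    using g l by (simp add: base.hom_one normal_form_closed)
  ultimately show ?thesis using g l(1)
    by (intro exI[of _ \<one>] exI[of _ "(e, g) # l"]) auto
qed

lemma ex_normal_form:
  assumes "X \<in> carrier H"
  shows "\<exists>g l. g \<in> carrier G \<and> snd ` set l \<subseteq> carrier G \<and> britton_reduced l \<and> X = normal_form g l"
proof -
  obtain u where u: "u \<in> hnn_words G" "X = cls u" using assms by (auto simp: carrier_HNN)
  have "\<exists>g l. g \<in> carrier G \<and> snd ` set l \<subseteq> carrier G \<and> britton_reduced l \<and> cls u = normal_form g l"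
    using u(1)
  proof (induction u)
    case Nil
    have "cls [] = normal_form \<one> []" by (simp add: base.hom_one one_HNN)
    then show ?case by (intro exI[of _ \<one>] exI[of _ "[]"]) simp
  next
    case (Cons x u)
    then obtain g l where gl: "g \<in> carrier G" "snd ` set l \<subseteq> carrier G" "britton_reduced l"
      "cls u = normal_form g l" by auto
    have w: "u \<in> hnn_words G" "[x] \<in> hnn_words G" using Cons.prems by auto
    have xu: "cls (x # u) = cls [x] \<otimes>\<^bsub>H\<^esub> normal_form g l"
      using mult_HNN[OF w(2,1)] gl(4) by simp
    from Cons.prems consider h where "x = Base h" "h \<in> carrier G" | "x = Stable \<or> x = Stable_inv"
      by auto
    then show ?case
    proof cases
      case 1
      then have "cls (x # u) = normal_form (h \<otimes> g) l"
        using xu gl base_mult_normal_form by (simp add: base_def)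
      then show ?thesis using 1 gl by blast
    next
      case 2
      then have "cls [x] = stable (x = Stable)" by (auto simp: stable_def)
      then show ?thesis using xu stable_mult_normal_form[OF gl(1-3)] by simp
    qed
  qed
  then show ?thesis using u(2) by blast
qed

text \<open>This is where the word sends the identity of \<open>G\<close> when \<open>G\<close> acts
  by left translation, t^-1 as \<open>twist\<close> and t as its inverse.\<close>

fun point :: "'a \<Rightarrow> (bool \<times> 'a) list \<Rightarrow> 'a" where
  "point g [] = g"
| "point g ((e, h) # l) = g \<otimes> (if e then untwist (point h l) else twist (point h l))"

text \<open>Each stable letter is recorded with the orbit that selects its shear. The asymmetry has
  a reason: t^-1 shears according to the point before it twists, so its inverse t must shear
  according to the point after untwisting.\<close>

fun orbit_letters :: "(bool \<times> 'a) list \<Rightarrow> ('a set \<times> bool) list" where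
  "orbit_letters [] = []"
| "orbit_letters ((e, h) # l) =
     (A #> (if e then untwist (point h l) else point h l), e) # orbit_letters l"

lemma point_closed:
  "g \<in> carrier G \<Longrightarrow> snd ` set l \<subseteq> carrier G \<Longrightarrow> point g l \<in> carrier G"
  by (induction g l rule: point.induct) (auto simp: untwist twist_closed)

text \<open>Suppose adjacent letters of opposite sign carry the same orbit. Then two points of that
  orbit differ by some \<open>d\<close> in \<open>A\<close>; cancelling the common point puts the
  middle syllable into \<open>A\<close>, directly for t^-1 h t, and as \<open>f d\<close> after
  applying \<open>twist\<close> for t h t^-1. Either way there is a pinch.\<close>

lemma freely_reduced_orbit_letters:
  "britton_reduced l \<Longrightarrow> snd ` set l \<subseteq> carrier G \<Longrightarrow> freely_reduced (orbit_letters l)"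
proof (induction l rule: britton_reduced.induct)
  case (1 e h e' h' l)
  let ?y = "point h' l"
  have c: "h \<in> carrier G" "h' \<in> carrier G" "?y \<in> carrier G" using 1 point_closed by auto
  have "e = e'"
    if eq: "A #> (if e then untwist (point h ((e', h') # l)) else point h ((e', h') # l)) =
      A #> (if e' then untwist ?y else ?y)"
  proof (rule ccontr)
    assume ne: "e \<noteq> e'"
    then have nA: "h \<notin> A" using 1 by simp
    have "h \<in> A"
    proof (cases e')
      case True
      have u: "untwist ?y \<in> carrier G" using untwist c by simp
      then obtain d where "d \<in> A" "h \<otimes> untwist ?y = d \<otimes> untwist ?y"
        using coset_A_eqD[OF u, of "h \<otimes> untwist ?y"] eq ne True c by auto
      then show ?thesis using u c A_carrier by simp
    next
      case False
      let ?z = "h \<otimes> twist ?y"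
      have z: "?z \<in> carrier G" using c twist_closed by simp
      obtain d where d: "d \<in> A" "untwist ?z = d \<otimes> ?y"
        using coset_A_eqD[OF c(3) untwist(1)[OF z]] eq ne False by auto
      have "?z = f d \<otimes> twist ?y"
        using untwist(2)[OF z] d twist_mult c by simp
      then show ?thesis using c d twist_closed f_closed A_carrier by simp
    qed
    then show False using nA by simp
  qed
  then show ?case using 1 by simp
qed auto

end

section \<open>The action on the skew product\<close>

lemma pow_DirProd:
  "(x, y) [^]\<^bsub>G \<times>\<times> K\<^esub> (m::nat) = (x [^]\<^bsub>G\<^esub> m, y [^]\<^bsub>K\<^esub> m)"
  by (induction m) (simp_all add: nat_pow_def)

text \<open>\<open>f_trivial\<close> expresses that \<open>f\<close> acts trivially on the factors
  that the series induces on \<open>A\<close>. It is an assumption of its own because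
  \<open>q\<close> becomes \<open>p ^ e\<close>, whereas the reason for it is that the factors of
  the series have exponent p.\<close>

locale hnn_action = hnn_twist G A f r a + finite_exp_series G q n N
  for G (structure) and A f r a q n N +
  fixes lab :: "nat \<Rightarrow> 'a set option" and R :: nat
  assumes q_gt_1: "q > 1"
    and r_cong: "x \<in> carrier G \<Longrightarrow> y \<in> carrier G \<Longrightarrow> N i #> x = N i #> y \<Longrightarrow> N i #> r x = N i #> r y"
    and f_trivial: "c \<in> A \<Longrightarrow> c \<in> N (Suc i) \<Longrightarrow> f c \<otimes> inv c \<in> N i"
    and A_comm: "c \<in> A \<Longrightarrow> d \<in> A \<Longrightarrow> c \<otimes> d = d \<otimes> c"
    and alt: "alternating_labels lab R"
begin

abbreviation "V \<equiv> vec_group q R"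
abbreviation "E \<equiv> G \<times>\<times> V"

lemma q_pos: "q > 0" using q_gt_1 by simp

sublocale V: comm_group V by (rule comm_group_vec_group[OF q_pos])

text \<open>The vectors are filtered below \<open>G\<close>. Shears at points of different orbits
  are unrelated, so two vectors may be compared only when their points coincide; above that, the
  whole vector group is factored out. The vectors take R + 1 steps, so \<open>N 0\<close> sits at
  index \<open>Suc R\<close>, where the two descriptions agree.\<close>

definition shift_series :: "nat \<Rightarrow> ('a \<times> (nat \<Rightarrow> int)) set" where
  "shift_series i = (if i \<le> R then {\<one>} \<times> vec_sub q R i else N (i - Suc R) \<times> carrier V)"

lemma vec_sub_all: "vec_sub q R (Suc R) = carrier V"
  by (auto simp: vec_sub_def)

lemma shift_series_le: "i \<le> Suc R \<Longrightarrow> shift_series i = {\<one>} \<times> vec_sub q R i"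
  using N_0 vec_sub_all by (auto simp: shift_series_def le_Suc_eq)

lemma shift_series_gt: "i > R \<Longrightarrow> shift_series i = N (i - Suc R) \<times> carrier V"
  by (simp add: shift_series_def)

lemma vec_pow_q: "v [^]\<^bsub>V\<^esub> q = \<one>\<^bsub>V\<^esub>"
  by (rule ext) (simp add: pow_vec_group[OF q_pos] one_vec_group)

lemma exp_series_shift: "exp_series q E (Suc R + n) shift_series"
  unfolding exp_series_def
proof (intro conjI allI)
  have "vec_sub q R 0 = {\<one>\<^bsub>V\<^esub>}"
    using q_pos by (auto simp: vec_sub_def carrier_vec_group one_vec_group fun_eq_iff)
      (metis linorder_not_le)
  then show "shift_series 0 = {\<one>\<^bsub>E\<^esub>}" by (simp add: shift_series_def)
  show "shift_series (Suc R + n) = carrier E" by (simp add: shift_series_def N_n)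
  fix i
  show "shift_series i \<lhd> E"
    using DirProd_normal[OF V.is_group one_is_normal normal_vec_sub[OF q_pos]]
      DirProd_normal[OF V.is_group N_normal V.normal_self]
    by (simp add: shift_series_def)
  have vs: "vec_sub q R i \<subseteq> vec_sub q R (Suc i)" by (auto simp: vec_sub_def)
  have vone: "\<one>\<^bsub>V\<^esub> \<in> vec_sub q R i" for i
    using normal_vec_sub[OF q_pos] by (metis normal_imp_subgroup subgroup.one_closed)
  have "shift_series i \<subseteq> shift_series (Suc i) \<and> (\<forall>x \<in> shift_series (Suc i). x [^]\<^bsub>E\<^esub> q \<in> shift_series i)"
  proof (cases "i \<le> R")
    case True
    then show ?thesis
      using vs vone vec_pow_q by (auto simp: shift_series_le pow_DirProd)
  next
    case False
    then have "Suc i - Suc R = Suc (i - Suc R)" by simp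
    then show ?thesis
      using False N_mono[of "i - Suc R"] N_pow vec_pow_q
      by (auto simp: shift_series_gt pow_DirProd)
  qed
  then show "shift_series i \<subseteq> shift_series (Suc i)"
    and "\<forall>x \<in> shift_series (Suc i). x [^]\<^bsub>E\<^esub> q \<in> shift_series i" by auto
qed

sublocale E: finite_exp_series E q "Suc R + n" shift_series
  by (intro finite_exp_series.intro finite_exp_series_axioms.intro DirProd_group is_group V.is_group
      exp_series_shift) (simp add: fin finite_vec_group)

text \<open>The values of \<open>r\<close> at the two points differ by some \<open>e\<close> in
  \<open>A\<close> and in \<open>N (Suc i)\<close>. As \<open>A\<close> is commutative, the factors
  that \<open>twist\<close> puts in front of \<open>x\<close> and \<open>y\<close> differ by
  \<open>f e \<otimes> inv e\<close>, which lies in \<open>N i\<close>. Modulo \<open>N i\<close>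
  both points are thus multiplied from the left by the same element, and it cancels.\<close>

lemma twist_series:
  assumes x: "x \<in> carrier G" and y: "y \<in> carrier G" and xy: "inv x \<otimes> y \<in> N (Suc i)"
  shows "N i #> (inv (twist x) \<otimes> twist y) = N i #> (inv x \<otimes> y)"
proof -
  define u v e where "u = r x" and "v = r y" and "e = inv (r x) \<otimes> r y"
  have uA: "u \<in> A" "v \<in> A" using x y r_closed by (auto simp: u_def v_def)
  have eA: "e \<in> A"
    using uA A by (simp add: e_def u_def v_def subgroup.m_closed subgroup.m_inv_closed)
  note C = A_carrier[OF uA(1)] A_carrier[OF uA(2)] A_carrier[OF eA]
    A_carrier[OF f_closed[OF uA(1)]] A_carrier[OF f_closed[OF eA]] A_carrier[OF f_closed[OF uA(2)]]
  have "N (Suc i) #> u = N (Suc i) #> v"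
    unfolding u_def v_def using xy by (intro r_cong x y) (simp add: N_coset_eq_iff x y)
  then have eN: "e \<in> N (Suc i)" using C by (simp add: N_coset_eq_iff e_def u_def v_def)
  have v: "v = u \<otimes> e" using C by (simp add: e_def u_def v_def m_assoc[symmetric])
  have feA: "f e \<otimes> inv e \<in> A" "inv u \<in> A"
    using eA uA f_closed A by (simp_all add: subgroup.m_closed subgroup.m_inv_closed)
  have "f v \<otimes> inv v = f u \<otimes> (f e \<otimes> inv e \<otimes> inv u)"
    using C uA eA by (simp add: v f_mult inv_mult_group m_assoc)
  also have "\<dots> = f u \<otimes> inv u \<otimes> (f e \<otimes> inv e)"
    unfolding A_comm[OF feA] using C by (simp add: m_assoc)
  finally have "N i #> (f v \<otimes> inv v) = N i #> (f u \<otimes> inv u \<otimes> (f e \<otimes> inv e))" by simp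
  also have "\<dots> = N i #> (f u \<otimes> inv u \<otimes> \<one>)"
  proof (rule N_coset_mult)
    show "N i #> (f e \<otimes> inv e) = N i #> \<one>"
      using N_coset_one_iff[of "f e \<otimes> inv e" i] f_trivial[OF eA eN] C
        subgroup.subset[OF N_subgroup] by simp
  qed (use C in auto)
  finally have d: "N i #> (f v \<otimes> inv v) = N i #> (f u \<otimes> inv u)" using C by simp
  have ty: "twist y = f v \<otimes> inv v \<otimes> y" and tx: "twist x = f u \<otimes> inv u \<otimes> x"
    using x y by (simp_all add: twist_def u_def v_def)
  have "N i #> (inv (twist x) \<otimes> (f v \<otimes> inv v \<otimes> y)) = N i #> (inv (twist x) \<otimes> (f u \<otimes> inv u \<otimes> y))"
    using C x y twist_closed by (intro N_coset_mult[OF _ _ _ _ HOL.refl] N_coset_mult[OF _ _ _ _ d]) auto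
  moreover have "inv (twist x) \<otimes> (f u \<otimes> inv u \<otimes> y) = inv x \<otimes> y"
  proof -
    let ?d = "f u \<otimes> inv u"
    have "inv (twist x) \<otimes> (?d \<otimes> y) = inv x \<otimes> (inv ?d \<otimes> ?d) \<otimes> y"
      using C x y by (simp only: tx inv_mult_group m_assoc m_closed inv_closed)
    then show ?thesis using C x y by simp
  qed
  ultimately show ?thesis using ty by simp
qed

definition skew :: "('a \<Rightarrow> 'a) \<Rightarrow> int \<Rightarrow> 'a \<times> (nat \<Rightarrow> int) \<Rightarrow> 'a \<times> (nat \<Rightarrow> int)" where
  "skew \<alpha> c = (\<lambda>z \<in> carrier E. (\<alpha> (fst z), mod_shear q lab c (A #> fst z) (snd z)))"

text \<open>For i at most R the hypothesis forces equal points, so one shear acts on both vectors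
  and \<open>vec_sub_mod_shear\<close> applies. For larger i the vectors are factored out and only
  the condition on \<open>\<alpha>\<close> remains.\<close>

lemma skew_series_perm:
  assumes closed: "\<And>x. x \<in> carrier G \<Longrightarrow> \<alpha> x \<in> carrier G" and inj: "inj_on \<alpha> (carrier G)"
    and ser: "\<And>i x y. x \<in> carrier G \<Longrightarrow> y \<in> carrier G \<Longrightarrow> inv x \<otimes> y \<in> N (Suc i) \<Longrightarrow>
      N i #> (inv (\<alpha> x) \<otimes> \<alpha> y) = N i #> (inv x \<otimes> y)"
  shows "skew \<alpha> c \<in> series_perms E shift_series"
proof -
  note msc = mod_shear_closed[OF q_pos alt]
  have skew_closed: "skew \<alpha> c z \<in> carrier E" if "z \<in> carrier E" for z
    using that closed msc by (auto simp: skew_def)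
  have inj_skew: "inj_on (skew \<alpha> c) (carrier E)"
  proof (rule inj_onI)
    fix z w assume z: "z \<in> carrier E" and w: "w \<in> carrier E" and eq: "skew \<alpha> c z = skew \<alpha> c w"
    have f: "fst z = fst w" using eq z w inj by (auto simp: skew_def inj_on_def)
    then have "mod_shear q lab c (A #> fst z) (snd z) = mod_shear q lab c (A #> fst z) (snd w)"
      using eq z w by (simp add: skew_def)
    then have "snd z = snd w"
      using mod_shear_cancel[OF q_pos alt] z w by (metis carrier_DirProd mem_Times_iff)
    then show "z = w" using f by (simp add: prod_eq_iff)
  qed
  moreover have "skew \<alpha> c ` carrier E = carrier E"
    by (rule endo_inj_surj[OF E.fin image_subsetI[OF skew_closed] inj_skew])
  ultimately have bij: "skew \<alpha> c \<in> Bij (carrier E)"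
    by (simp add: Bij_def bij_betw_def skew_def)
  have "shift_series i #>\<^bsub>E\<^esub> (inv\<^bsub>E\<^esub> skew \<alpha> c z \<otimes>\<^bsub>E\<^esub> skew \<alpha> c w) = shift_series i #>\<^bsub>E\<^esub> (inv\<^bsub>E\<^esub> z \<otimes>\<^bsub>E\<^esub> w)"
    if z: "z \<in> carrier E" and w: "w \<in> carrier E" and d: "inv\<^bsub>E\<^esub> z \<otimes>\<^bsub>E\<^esub> w \<in> shift_series (Suc i)" for i z w
  proof -
    obtain x v where zx: "z = (x, v)" by (cases z)
    obtain y u where wy: "w = (y, u)" by (cases w)
    have c: "x \<in> carrier G" "y \<in> carrier G" "v \<in> carrier V" "u \<in> carrier V"
      using z w zx wy by auto
    define v' u' where "v' = mod_shear q lab c (A #> x) v" and "u' = mod_shear q lab c (A #> y) u"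
    have c': "v' \<in> carrier V" "u' \<in> carrier V" "\<alpha> x \<in> carrier G" "\<alpha> y \<in> carrier G"
      using c msc closed by (auto simp: v'_def u'_def)
    have sk: "skew \<alpha> c z = (\<alpha> x, v')" "skew \<alpha> c w = (\<alpha> y, u')"
      using z w by (simp_all add: skew_def zx wy v'_def u'_def)
    note invE = inv_DirProd[OF is_group V.is_group]
    have d1: "(inv x \<otimes> y, inv\<^bsub>V\<^esub> v \<otimes>\<^bsub>V\<^esub> u) \<in> shift_series (Suc i)"
      using d c by (simp add: zx wy invE)
    have "(inv (inv (\<alpha> x) \<otimes> \<alpha> y) \<otimes> (inv x \<otimes> y),
       inv\<^bsub>V\<^esub> (inv\<^bsub>V\<^esub> v' \<otimes>\<^bsub>V\<^esub> u') \<otimes>\<^bsub>V\<^esub> (inv\<^bsub>V\<^esub> v \<otimes>\<^bsub>V\<^esub> u)) \<in> shift_series i"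
    proof (cases "i \<le> R")
      case True
      then have "inv x \<otimes> y = \<one>" and dv: "inv\<^bsub>V\<^esub> v \<otimes>\<^bsub>V\<^esub> u \<in> vec_sub q R (Suc i)"
        using d1 by (auto simp: shift_series_le)
      then have "x = y" using c by (metis inv_closed inv_equality inv_inv)
      then show ?thesis
        using True c c' vec_sub_mod_shear[OF q_pos alt c(3,4) dv, of c "A #> x"]
        by (simp add: shift_series_le v'_def u'_def)
    next
      case False
      then have i: "Suc i - Suc R = Suc (i - Suc R)" by simp
      then have "inv x \<otimes> y \<in> N (Suc (i - Suc R))"
        using d1 False by (simp add: shift_series_gt)
      then have "inv (inv (\<alpha> x) \<otimes> \<alpha> y) \<otimes> (inv x \<otimes> y) \<in> N (i - Suc R)"
        using ser[OF c(1,2)] c c' by (subst N_coset_eq_iff[symmetric]) auto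
      then show ?thesis using False c c' by (simp add: shift_series_gt)
    qed
    then have "inv\<^bsub>E\<^esub> (inv\<^bsub>E\<^esub> (\<alpha> x, v') \<otimes>\<^bsub>E\<^esub> (\<alpha> y, u')) \<otimes>\<^bsub>E\<^esub> (inv\<^bsub>E\<^esub> (x, v) \<otimes>\<^bsub>E\<^esub> (y, u)) \<in> shift_series i"
      using c c' by (simp add: invE)
    then show ?thesis
      unfolding sk unfolding zx wy using c c' by (subst E.N_coset_eq_iff) (auto simp: invE)
  qed
  then show ?thesis using bij by (simp add: series_perms_def)
qed

abbreviation "\<Gamma> \<equiv> series_perm_group E shift_series"

sublocale \<Gamma>: group \<Gamma>
  using subgroup.subgroup_is_group[OF E.subgroup_series_perms[OF q_pos] group_BijGroup] .

lemma \<Gamma>_mult_apply: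
  assumes "\<sigma> \<in> carrier \<Gamma>" "\<tau> \<in> carrier \<Gamma>" "z \<in> carrier E"
  shows "(\<sigma> \<otimes>\<^bsub>\<Gamma>\<^esub> \<tau>) z = \<sigma> (\<tau> z)"
  using assms E.series_permsD(1) by (simp add: mult_BijGroup_apply)

lemma \<Gamma>_eqI:
  assumes "\<sigma> \<in> carrier \<Gamma>" "\<tau> \<in> carrier \<Gamma>" "\<And>z. z \<in> carrier E \<Longrightarrow> \<sigma> z = \<tau> z"
  shows "\<sigma> = \<tau>"
proof (rule extensionalityI)
  show "\<sigma> \<in> extensional (carrier E)" "\<tau> \<in> extensional (carrier E)"
    using assms(1,2) by (auto intro: Bij_imp_extensional E.series_permsD(1) simp del: carrier_DirProd)
qed (rule assms(3))

text \<open>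
  With \<open>c = 0\<close> the shear is the identity on reduced vectors, so left translations are skew
  maps as well.
\<close>

definition left_perm :: "'a \<Rightarrow> 'a \<times> (nat \<Rightarrow> int) \<Rightarrow> 'a \<times> (nat \<Rightarrow> int)" where
  "left_perm g = skew ((\<otimes>) g) 0"

definition stable_inv_perm :: "'a \<times> (nat \<Rightarrow> int) \<Rightarrow> 'a \<times> (nat \<Rightarrow> int)" where
  "stable_inv_perm = skew twist (-1)"

lemma left_perm_apply:
  "x \<in> carrier G \<Longrightarrow> v \<in> carrier V \<Longrightarrow> left_perm g (x, v) = (g \<otimes> x, v)"
  by (auto simp: left_perm_def skew_def mod_shear_def shear_def carrier_vec_group)

lemma stable_inv_perm_apply:
  "x \<in> carrier G \<Longrightarrow> v \<in> carrier V \<Longrightarrow>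
     stable_inv_perm (x, v) = (twist x, mod_shear q lab (-1) (A #> x) v)"
  by (simp add: stable_inv_perm_def skew_def)

lemma left_perm_closed:
  assumes g: "g \<in> carrier G" shows "left_perm g \<in> carrier \<Gamma>"
proof -
  have "inv (g \<otimes> x) \<otimes> (g \<otimes> y) = inv x \<otimes> y" if "x \<in> carrier G" "y \<in> carrier G" for x y
  proof -
    have "inv (g \<otimes> x) \<otimes> (g \<otimes> y) = inv x \<otimes> (inv g \<otimes> g) \<otimes> y"
      using g that by (simp only: inv_mult_group m_assoc m_closed inv_closed)
    then show ?thesis using g that by simp
  qed
  then show ?thesis
    unfolding left_perm_def using g by (simp add: skew_series_perm inj_on_def)
qed

lemma stable_inv_perm_closed: "stable_inv_perm \<in> carrier \<Gamma>"
  unfolding stable_inv_perm_def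
  using skew_series_perm[of twist "-1"] twist_closed twist_Bij twist_series
  by (simp add: Bij_def bij_betw_def)

text \<open>The relation holds in the vector component because \<open>x\<close> and
  \<open>a \<otimes> x\<close> lie in one orbit of \<open>A\<close> and so select the same shear.
  The universal property asks for the image of t, which is the inverse of
  \<open>stable_inv_perm\<close>.\<close>

lemma ex_hnn_action:
  "\<exists>F \<in> hom H \<Gamma>. (\<forall>g \<in> carrier G. F (base g) = left_perm g) \<and> F (stable False) = stable_inv_perm"
proof -
  have hom: "left_perm \<in> hom G \<Gamma>"
  proof (rule homI)
    fix g h assume g: "g \<in> carrier G" "h \<in> carrier G"
    show "left_perm (g \<otimes> h) = left_perm g \<otimes>\<^bsub>\<Gamma>\<^esub> left_perm h"
    proof (rule \<Gamma>_eqI)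
      fix z assume "z \<in> carrier E"
      then show "left_perm (g \<otimes> h) z = (left_perm g \<otimes>\<^bsub>\<Gamma>\<^esub> left_perm h) z"
        using \<Gamma>_mult_apply[OF left_perm_closed[OF g(1)] left_perm_closed[OF g(2)]] g
        by (auto simp: left_perm_apply m_assoc)
    qed (use g left_perm_closed \<Gamma>.m_closed in blast)+
  qed (rule left_perm_closed)
  have b: "f a \<in> carrier G" using f_closed[OF a_in_A] A_carrier by simp
  have "stable_inv_perm \<otimes>\<^bsub>\<Gamma>\<^esub> left_perm a = left_perm (f a) \<otimes>\<^bsub>\<Gamma>\<^esub> stable_inv_perm"
  proof (rule \<Gamma>_eqI)
    fix z assume "z \<in> carrier E"
    then obtain x v where z: "z = (x, v)" "x \<in> carrier G" "v \<in> carrier V" by auto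
    have "mod_shear q lab (- 1) (A #> x) v \<in> carrier V" using mod_shear_closed[OF q_pos alt z(3)] .
    then show "(stable_inv_perm \<otimes>\<^bsub>\<Gamma>\<^esub> left_perm a) z = (left_perm (f a) \<otimes>\<^bsub>\<Gamma>\<^esub> stable_inv_perm) z"
      using z \<Gamma>_mult_apply[OF stable_inv_perm_closed left_perm_closed[OF a_in]]
        \<Gamma>_mult_apply[OF left_perm_closed[OF b] stable_inv_perm_closed]
        a_in a_in_A twist_mult[OF a_in_A] twist_closed coset_A_mult[OF a_in_A]
      by (simp add: left_perm_apply stable_inv_perm_apply)
  qed (use a_in b left_perm_closed stable_inv_perm_closed \<Gamma>.m_closed in blast)+
  then have "inv\<^bsub>\<Gamma>\<^esub> (inv\<^bsub>\<Gamma>\<^esub> stable_inv_perm) \<otimes>\<^bsub>\<Gamma>\<^esub> left_perm a \<otimes>\<^bsub>\<Gamma>\<^esub> inv\<^bsub>\<Gamma>\<^esub> stable_inv_perm = left_perm (f a)"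
    using \<Gamma>.inv_solve_right'[of "left_perm (f a)" "stable_inv_perm \<otimes>\<^bsub>\<Gamma>\<^esub> left_perm a" stable_inv_perm]
      left_perm_closed[OF b] left_perm_closed[OF a_in] stable_inv_perm_closed
      \<Gamma>.inv_inv \<Gamma>.m_closed by metis
  from HNN_universal[OF \<Gamma>.is_group hom \<Gamma>.inv_closed[OF stable_inv_perm_closed] this]
  obtain F where F: "F \<in> hom H \<Gamma>" "\<forall>g \<in> carrier G. F (base g) = left_perm g"
    "F (cls [Stable]) = inv\<^bsub>\<Gamma>\<^esub> stable_inv_perm"
    by (auto simp: base_def)
  interpret F: group_hom H \<Gamma> F by unfold_locales (rule F(1))
  have "F (stable False) = inv\<^bsub>\<Gamma>\<^esub> F (stable True)"
    using F.hom_inv[of "stable True"] by (simp add: stable_inv)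
  also have "\<dots> = stable_inv_perm"
    using F(3) \<Gamma>.inv_inv[OF stable_inv_perm_closed] by (simp add: stable_def)
  finally show ?thesis using F(1,2) by blast
qed

definition start :: "nat \<Rightarrow> int" where
  "start j = (if j = 0 then 1 else 0)"

lemma start_closed: "start \<in> carrier V"
  using q_gt_1 by (simp add: start_def carrier_vec_group)

text \<open>Both components are followed together, since the point reached so far selects the next
  shear.\<close>

lemma normal_form_action:
  assumes F: "F \<in> hom H \<Gamma>" "\<forall>g \<in> carrier G. F (base g) = left_perm g" "F (stable False) = stable_inv_perm"
    and g: "g \<in> carrier G" and l: "snd ` set l \<subseteq> carrier G"
  shows "(\<lambda>j. shear_word lab (orbit_letters l) j mod int q) \<in> carrier V \<and>
    F (normal_form g l) (\<one>, start) = (point g l, \<lambda>j. shear_word lab (orbit_letters l) j mod int q)"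
  using g l
proof (induction g l rule: normal_form.induct)
  case (1 g)
  note start_closed
  moreover have "(\<lambda>j. shear_word lab (orbit_letters []) j mod int q) = start"
    using q_gt_1 by (auto simp: start_def)
  ultimately show ?case using 1 F(2) by (simp add: left_perm_apply)
next
  case (2 g e h l)
  interpret F: group_hom H \<Gamma> F by unfold_locales (rule F(1))
  let ?y = "point h l" and ?w = "\<lambda>j. shear_word lab (orbit_letters l) j mod int q"
  let ?x = "if e then untwist ?y else ?y"
  let ?c = "exponent_sign e"
  have h: "h \<in> carrier G" "snd ` set l \<subseteq> carrier G" and g: "g \<in> carrier G" using 2 by auto
  have y: "?y \<in> carrier G" by (rule point_closed[OF h])
  have w: "?w \<in> carrier V" and IH: "F (normal_form h l) (\<one>, start) = (?y, ?w)"
    using "2.IH"[OF h] by auto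
  have new: "(\<lambda>j. shear_word lab (orbit_letters ((e, h) # l)) j mod int q) = mod_shear q lab ?c (A #> ?x) ?w"
    by (simp add: mod_shear_mod)
  have w': "mod_shear q lab ?c (A #> ?x) ?w \<in> carrier V" by (rule mod_shear_closed[OF q_pos alt w])
  have st: "F (stable e) (?y, ?w) = ((if e then untwist ?y else twist ?y), mod_shear q lab ?c (A #> ?x) ?w)"
  proof (cases e)
    case False
    then show ?thesis using F(3) y w by (simp add: stable_inv_perm_apply exponent_sign_def)
  next
    case True
    \<comment> \<open>\<open>F\<close> is given explicitly on t^-1 only, so the action of t is found
      by exhibiting the preimage under \<open>stable_inv_perm\<close>.\<close>
    let ?z = "(untwist ?y, mod_shear q lab 1 (A #> untwist ?y) ?w)"
    have zE: "?z \<in> carrier E" using untwist[OF y] mod_shear_closed[OF q_pos alt w] by simp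
    have "stable_inv_perm ?z = (?y, ?w)"
      using untwist[OF y] mod_shear_closed[OF q_pos alt w] mod_shear_cancel[OF q_pos alt w, of 1]
      by (simp add: stable_inv_perm_apply)
    then have "F (stable True) (?y, ?w) = (F (stable True) \<otimes>\<^bsub>\<Gamma>\<^esub> F (stable False)) ?z"
      using \<Gamma>_mult_apply[OF F.hom_closed F.hom_closed zE, of "stable True" "stable False"] F(3) by simp
    also have "\<dots> = F \<one>\<^bsub>H\<^esub> ?z"
      using F.hom_mult[OF stable_closed stable_closed, of True False] stable_not[of False]
      by (simp only: not_False_eq_True)
    also have "\<dots> = ?z" using zE by (simp add: BijGroup_def)
    finally show ?thesis using True by (simp add: exponent_sign_def)
  qed
  have nf: "normal_form h l \<in> carrier H" by (rule normal_form_closed[OF h])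
  have one: "(\<one>, start) \<in> carrier E" using start_closed by simp
  have "F (stable e \<otimes>\<^bsub>H\<^esub> normal_form h l) (\<one>, start) = F (stable e) (?y, ?w)"
    using nf \<Gamma>_mult_apply[OF F.hom_closed F.hom_closed one, of "stable e" "normal_form h l"] IH
    by simp
  then have "F (normal_form g ((e, h) # l)) (\<one>, start) =
      left_perm g ((if e then untwist ?y else twist ?y), mod_shear q lab ?c (A #> ?x) ?w)"
    using nf g F(2) st
      \<Gamma>_mult_apply[OF F.hom_closed F.hom_closed one, of "base g" "stable e \<otimes>\<^bsub>H\<^esub> normal_form h l"]
    by simp
  also have "\<dots> = (point g ((e, h) # l), mod_shear q lab ?c (A #> ?x) ?w)"
    using w' untwist[OF y] twist_closed[OF y] by (simp add: left_perm_apply)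
  finally show ?case using w' unfolding new by simp
qed

end

section \<open>The criterion\<close>

lemma exp_series_power:
  assumes G: "group G" and ser: "exp_series p G n N" and e: "e > 0"
  shows "exp_series (p ^ e) G n N"
proof -
  interpret group G by (rule G)
  have "x [^]\<^bsub>G\<^esub> (p ^ e) \<in> N i" if x: "x \<in> N (Suc i)" for x i
  proof -
    have sub: "subgroup (N j) G" for j using ser by (simp add: exp_series_def normal_imp_subgroup)
    have "x \<in> carrier G" using x sub subgroup.mem_carrier by metis
    then have "x [^]\<^bsub>G\<^esub> (p ^ e) = (x [^]\<^bsub>G\<^esub> p) [^]\<^bsub>G\<^esub> (p ^ (e - 1))"
      using e by (simp add: nat_pow_pow power_eq_if)
    moreover have "x [^]\<^bsub>G\<^esub> p \<in> N i" using ser x by (simp add: exp_series_def)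
    then have "(x [^]\<^bsub>G\<^esub> p) [^]\<^bsub>G\<^esub> (m::nat) \<in> N i" for m
      by (induction m) (use sub[of i] in \<open>auto simp: subgroup.one_closed subgroup.m_closed\<close>)
    ultimately show ?thesis by simp
  qed
  then show ?thesis using ser by (simp add: exp_series_def)
qed

text \<open>Restricting the target to the image makes the map surjective, and a subgroup of a finite
  p-group is again one by Lagrange's theorem.\<close>

lemma ex_nat_p_quotient:
  assumes p: "prime p" and K: "finite_p_group p K" and G: "group G" and F: "F \<in> hom G K"
    and x: "x \<in> carrier G" "F x \<noteq> \<one>\<^bsub>K\<^esub>"
  shows "\<exists>(M :: nat monoid) f. finite_p_group p M \<and> f \<in> epi G M \<and> f x \<noteq> \<one>\<^bsub>M\<^esub>"
proof -
  interpret F: group_hom G K F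
    using G K F by (simp add: group_hom_def group_hom_axioms_def finite_p_group_def)
  let ?I = "K\<lparr>carrier := F ` carrier G\<rparr>"
  obtain n where n: "order K = p ^ n" using K by (auto simp: finite_p_group_def)
  have sub: "subgroup (F ` carrier G) K" by (rule F.img_is_subgroup)
  have "card (F ` carrier G) dvd p ^ n"
    using F.H.lagrange[OF sub] n by (metis dvd_triv_right)
  then have "finite_p_group p ?I"
    using subgroup.subgroup_is_group[OF sub F.H.is_group] K sub p
      finite_subset[OF subgroup.subset[OF sub]]
    by (auto simp: finite_p_group_def order_def divides_primepow_nat)
  moreover have "F \<in> epi G ?I" by (auto simp: epi_def hom_def)
  ultimately show ?thesis using x ex_nat_quotient[of p ?I F G x] by simp
qed

text \<open>Fermat's theorem in the form j^p = j, applied s times. It is used for naturals, so j is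
  first replaced by its residue.\<close>

lemma int_pow_prime_power_cong:
  assumes p: "prime p" and k: "coprime k (int p)"
  shows "[k ^ (p ^ s) = k] (mod int p)"
proof -
  have step: "[j ^ p = j] (mod int p)" if j: "coprime j (int p)" for j
  proof -
    define m where "m = nat (j mod int p)"
    have m: "[int m = j] (mod int p)"
      using prime_gt_0_nat[OF p] by (simp add: m_def cong_def)
    have "\<not> p dvd m"
    proof
      assume "p dvd m"
      then have "int p dvd j" using m cong_dvd_iff by (metis int_dvd_int_iff cong_sym)
      then have "is_unit (int p)" by (rule coprime_common_divisor[OF j _ dvd_refl])
      then show False using prime_gt_1_nat[OF p] by simp
    qed
    then have "[m ^ (p - 1) = 1] (mod p)" by (rule fermat_theorem[OF p])
    then have "[m ^ (p - 1) * m = 1 * m] (mod p)" by (rule cong_scalar_right)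
    then have "[m ^ p = m] (mod p)"
      using prime_gt_0_nat[OF p] power_minus_mult[of p m] by simp
    then have "[int m ^ p = int m] (mod int p)"
      using cong_int_iff[of "m ^ p" m p] by simp
    moreover have "[j ^ p = int m ^ p] (mod int p)" by (rule cong_pow[OF cong_sym[OF m]])
    ultimately show ?thesis using m cong_trans by blast
  qed
  show ?thesis
  proof (induction s)
    case (Suc s)
    have "[k ^ (p ^ Suc s) = k ^ (p ^ s)] (mod int p)"
      using step[of "k ^ (p ^ s)"] k by (simp add: power_mult[symmetric] mult.commute)
    then show ?case using Suc cong_trans by blast
  qed simp
qed

section \<open>Necessity of the congruence\<close>

context hnn_twist
begin

text \<open>The extension acts on \<open>G\<close> with \<open>base g\<close> as left translation
  and t^-1 as \<open>twist\<close>, and left translation by \<open>g\<close> moves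
  \<open>\<one>\<close> to \<open>g\<close>. The relation needs only equivariance of
  \<open>r\<close>, so this works for every automorphism \<open>f\<close> of
  \<open>A\<close>.\<close>

lemma base_eq_one_iff:
  assumes g: "g \<in> carrier G" shows "base g = \<one>\<^bsub>H\<^esub> \<longleftrightarrow> g = \<one>"
proof
  assume g1: "base g = \<one>\<^bsub>H\<^esub>"
  let ?B = "BijGroup (carrier G)"
  interpret B: group ?B by (rule group_BijGroup)
  define L where "L g = (\<lambda>x \<in> carrier G. g \<otimes> x)" for g
  have L_Bij: "L g \<in> Bij (carrier G)" if g: "g \<in> carrier G" for g
  proof -
    have "inj_on (L g) (carrier G)" using g by (simp add: inj_on_def L_def)
    moreover have "L g ` carrier G = carrier G"
      by (rule endo_inj_surj[OF fin _ calculation]) (use g in \<open>auto simp: L_def\<close>)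
    ultimately show ?thesis by (simp add: Bij_def bij_betw_def L_def)
  qed
  have Bij_eqI: "\<sigma> = \<tau>"
    if "\<sigma> \<in> Bij (carrier G)" "\<tau> \<in> Bij (carrier G)" "\<And>x. x \<in> carrier G \<Longrightarrow> \<sigma> x = \<tau> x" for \<sigma> \<tau>
    using that Bij_imp_extensional by (metis extensionalityI)
  note Bm = B.m_closed[unfolded carrier_BijGroup]
  have hom: "L \<in> hom G ?B"
  proof (rule homI)
    fix x y assume xy: "x \<in> carrier G" "y \<in> carrier G"
    show "L (x \<otimes> y) = L x \<otimes>\<^bsub>?B\<^esub> L y"
      by (rule Bij_eqI) (use xy L_Bij Bm in \<open>auto simp: mult_BijGroup_apply\<close>, simp add: L_def m_assoc)
  qed (simp add: L_Bij carrier_BijGroup)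
  have fa: "f a \<in> carrier G" using f_closed[OF a_in_A] A_carrier by simp
  have "twist \<otimes>\<^bsub>?B\<^esub> L a = L (f a) \<otimes>\<^bsub>?B\<^esub> twist"
  proof (rule Bij_eqI)
    fix x assume "x \<in> carrier G"
    then show "(twist \<otimes>\<^bsub>?B\<^esub> L a) x = (L (f a) \<otimes>\<^bsub>?B\<^esub> twist) x"
      using L_Bij[OF a_in] L_Bij[OF fa] twist_Bij twist_mult[OF a_in_A] twist_closed
      by (simp add: mult_BijGroup_apply L_def)
  qed (use a_in fa L_Bij twist_Bij Bm in blast)+
  then have "inv\<^bsub>?B\<^esub> (inv\<^bsub>?B\<^esub> twist) \<otimes>\<^bsub>?B\<^esub> L a \<otimes>\<^bsub>?B\<^esub> inv\<^bsub>?B\<^esub> twist = L (f a)"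
    using B.inv_solve_right'[of "L (f a)" "twist \<otimes>\<^bsub>?B\<^esub> L a" twist]
      L_Bij[OF fa] L_Bij[OF a_in] twist_Bij B.inv_inv Bm carrier_BijGroup by metis
  from HNN_universal[OF B.is_group hom B.inv_closed this] twist_Bij
  obtain F where F: "F \<in> hom H ?B" "F (base g) = L g"
    using g by (auto simp: base_def carrier_BijGroup)
  have "L g = \<one>\<^bsub>?B\<^esub>" using F g1 hom_one[OF F(1) H.is_group B.is_group] by simp
  then have "L g \<one> = \<one>" by (simp add: BijGroup_def)
  then show "g = \<one>" using g by (simp add: L_def)
qed (simp add: base.hom_one)

lemma base_mult_stable_pow:
  assumes f_pow: "\<And>c. c \<in> A \<Longrightarrow> f c = c [^] (k::int)" and c: "c \<in> A"
  shows "base c \<otimes>\<^bsub>H\<^esub> stable True [^]\<^bsub>H\<^esub> (m::nat)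
    = stable True [^]\<^bsub>H\<^esub> m \<otimes>\<^bsub>H\<^esub> base (c [^] (k ^ m))"
proof (induction m)
  case 0
  then show ?case using A_carrier[OF c] by simp
next
  case (Suc m)
  let ?t = "stable True"
  let ?d = "c [^] (k ^ m)"
  have d: "?d \<in> A" using f_int_pow(1)[OF c] .
  have "base c \<otimes>\<^bsub>H\<^esub> ?t [^]\<^bsub>H\<^esub> Suc m = base c \<otimes>\<^bsub>H\<^esub> ?t [^]\<^bsub>H\<^esub> m \<otimes>\<^bsub>H\<^esub> ?t"
    using A_carrier[OF c] by (simp add: H.m_assoc)
  also have "\<dots> = ?t [^]\<^bsub>H\<^esub> m \<otimes>\<^bsub>H\<^esub> (base ?d \<otimes>\<^bsub>H\<^esub> ?t)"
    unfolding Suc.IH using A_carrier[OF d] by (simp add: H.m_assoc)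
  also have "\<dots> = ?t [^]\<^bsub>H\<^esub> Suc m \<otimes>\<^bsub>H\<^esub> base (f ?d)"
    unfolding stable_conj_A[OF d] using A_carrier[OF f_closed[OF d]] by (simp add: H.m_assoc)
  also have "f ?d = c [^] (k ^ Suc m)"
    using f_pow[OF d] A_carrier[OF c] by (simp add: int_pow_pow mult.commute)
  finally show ?case .
qed

lemma residually_p_imp_cong:
  assumes p: "prime p" and k: "coprime k (int p)" and a: "a \<noteq> \<one>"
    and f_pow: "\<And>c. c \<in> A \<Longrightarrow> f c = c [^] (k::int)"
    and res: "residually_finite_p_group p H"
  shows "[k = 1] (mod int p)"
proof -
  have "base a \<noteq> \<one>\<^bsub>H\<^esub>" using base_eq_one_iff a_in a by simp
  then obtain K :: "nat monoid" and F where K: "finite_p_group p K" and F: "F \<in> epi H K"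
    and ne: "F (base a) \<noteq> \<one>\<^bsub>K\<^esub>"
    using res a_in unfolding residually_finite_p_group_def by (meson base_closed)
  obtain s where s: "order K = p ^ s" using K by (auto simp: finite_p_group_def)
  interpret F: group_hom H K F
    using K F H.is_group by (simp add: group_hom_def group_hom_axioms_def finite_p_group_def epi_def)
  let ?x = "F (base a)" and ?t = "stable True [^]\<^bsub>H\<^esub> (p ^ s)"
  have x: "?x \<in> carrier K" using a_in by simp
  have t: "F ?t = \<one>\<^bsub>K\<^esub>"
    using F.H.pow_order_eq_1[of "F (stable True)"] s by (simp add: F.hom_nat_pow)
  have "F (base a \<otimes>\<^bsub>H\<^esub> ?t) = F (?t \<otimes>\<^bsub>H\<^esub> base (a [^] (k ^ (p ^ s))))"
    using base_mult_stable_pow[OF f_pow a_in_A] by simp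
  then have "?x = F (base (a [^] (k ^ (p ^ s))))"
    using t a_in by simp
  also have "\<dots> = ?x [^]\<^bsub>K\<^esub> (k ^ (p ^ s))"
    using a_in by (simp add: base.hom_int_pow F.hom_int_pow)
  finally have "?x [^]\<^bsub>K\<^esub> (1::int) = ?x [^]\<^bsub>K\<^esub> (k ^ (p ^ s))" using x by simp
  then have o: "int (F.H.ord ?x) dvd k ^ (p ^ s) - 1" by (rule iffD1[OF F.H.int_pow_eq[OF x]])
  \<comment> \<open>A non-identity element of a finite p-group has order divisible by p, so the
    congruence modulo this order descends to one modulo p.\<close>
  have "F.H.ord ?x dvd p ^ s" using F.H.ord_dvd_group_order[OF x] s by simp
  moreover have "F.H.ord ?x \<noteq> 1" using F.H.ord_eq_1[OF x] ne by simp
  ultimately have "p dvd F.H.ord ?x"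
    using p by (metis divides_primepow_nat dvd_power gr0I power_0)
  then have "int p dvd k ^ (p ^ s) - 1" using o by (meson dvd_trans int_dvd_int_iff)
  then have "[k ^ (p ^ s) = 1] (mod int p)" by (simp add: cong_iff_dvd_diff)
  then show ?thesis using int_pow_prime_power_cong[OF p k, of s] cong_sym cong_trans by blast
qed

end

text \<open>Each element gets its own quotient: the labels, their bound R and the exponent e are all
  read off a reduced form of \<open>X\<close>.\<close>

lemma (in finite_exp_series) hnn_residually_p:
  assumes p: "prime p" and q: "q = p"
    and A: "subgroup A G" "A = generate G {a}" "a \<in> carrier G"
    and f_mult: "\<And>c d. c \<in> A \<Longrightarrow> d \<in> A \<Longrightarrow> f (c \<otimes> d) = f c \<otimes> f d"
    and f_bij: "bij_betw f A A"
    and A_comm: "\<And>c d. c \<in> A \<Longrightarrow> d \<in> A \<Longrightarrow> c \<otimes> d = d \<otimes> c"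
    and f_trivial: "\<And>c i. c \<in> A \<Longrightarrow> c \<in> N (Suc i) \<Longrightarrow> f c \<otimes> inv c \<in> N i"
  shows "residually_finite_p_group p (HNN G a (f a))"
  unfolding residually_finite_p_group_def
proof (intro ballI impI)
  obtain r where r: "\<And>x. x \<in> carrier G \<Longrightarrow> r x \<in> A"
    "\<And>c x. c \<in> A \<Longrightarrow> x \<in> carrier G \<Longrightarrow> r (c \<otimes> x) = c \<otimes> r x"
    and r_cong: "\<And>i x y. x \<in> carrier G \<Longrightarrow> y \<in> carrier G \<Longrightarrow> N i #> x = N i #> y \<Longrightarrow> N i #> r x = N i #> r y"
    using ex_equivariant_map[OF A(1)] by metis
  interpret hnn_twist G A f r a
    by (intro hnn_twist.intro equivariant_twist.intro equivariant_twist_axioms.intro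
        hnn_twist_axioms.intro) (fact is_group fin A f_mult f_bij r)+
  fix X assume X: "X \<in> carrier H" "X \<noteq> \<one>\<^bsub>H\<^esub>"
  obtain g l where gl: "g \<in> carrier G" "snd ` set l \<subseteq> carrier G" "britton_reduced l"
    "X = normal_form g l" using ex_normal_form[OF X(1)] by blast
  have red: "freely_reduced (orbit_letters l)" by (rule freely_reduced_orbit_letters[OF gl(3,2)])
  obtain R lab where alt: "alternating_labels lab R"
    and nz: "l = [] \<or> (R > 0 \<and> shear_word lab (orbit_letters l) R \<noteq> 0)"
  proof (cases "l = []")
    case True
    \<comment> \<open>Without stable letters the point component alone detects \<open>X\<close>, and
      an empty labelling suffices.\<close>
    then show ?thesis
      using that[of "\<lambda>_. None" 0] by (simp add: alternating_labels_def)
  next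
    case False
    then have "orbit_letters l \<noteq> []" by (cases l) auto
    then show ?thesis using ex_shear_labels[OF red] that by blast
  qed
  define w where "w = shear_word lab (orbit_letters l)"
  \<comment> \<open>Since e < p^e, the modulus exceeds the absolute value of entry R, so a non-zero
    entry stays non-zero. The successor also makes e positive, which raising the exponent of the
    series from p to \<open>p ^ e\<close> requires.\<close>
  define e where "e = Suc (nat \<bar>w R\<bar>)"
  have p1: "p > 1" by (rule prime_gt_1_nat[OF p])
  have bound: "\<bar>w R\<bar> < int (p ^ e)"
  proof -
    have "e < p ^ e" using p1 by (simp add: power_gt_expt)
    then show ?thesis unfolding e_def by linarith
  qed
  have pe: "p ^ e > 1" by (rule one_less_power[OF p1]) (simp add: e_def)
  have ser: "exp_series (p ^ e) G n N"
    by (rule exp_series_power[OF is_group series[unfolded q]]) (simp add: e_def)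
  interpret act: hnn_action G A f r a "p ^ e" n N lab R
    by unfold_locales (fact fin ser pe r_cong f_trivial A_comm alt)+
  obtain F where F: "F \<in> hom H act.\<Gamma>" "\<forall>g \<in> carrier G. F (base g) = act.left_perm g"
    "F (stable False) = act.stable_inv_perm"
    using act.ex_hnn_action by blast
  have val: "F X (\<one>, act.start) = (point g l, \<lambda>j. w j mod int (p ^ e))"
    using act.normal_form_action[OF F gl(1,2)] gl(4) by (simp add: w_def)
  have one: "\<one>\<^bsub>act.\<Gamma>\<^esub> (\<one>, act.start) = (\<one>, act.start)"
    using act.start_closed by (simp add: BijGroup_def)
  have "F X \<noteq> \<one>\<^bsub>act.\<Gamma>\<^esub>"
  proof
    assume "F X = \<one>\<^bsub>act.\<Gamma>\<^esub>"
    then have eq: "point g l = \<one>" "(\<lambda>j. w j mod int (p ^ e)) = act.start"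
      using val one by (auto simp del: power_Suc)
    show False
    proof (cases "l = []")
      case True
      then show False using eq(1) X(2) gl(4) by (simp add: base.hom_one)
    next
      case False
      then have R: "R > 0" "w R \<noteq> 0" using nz by (auto simp: w_def)
      \<comment> \<open>That R is positive matters: \<open>start\<close> is 1 at entry 0 and
        vanishes at all others.\<close>
      have "w R mod int (p ^ e) = 0" using fun_cong[OF eq(2), of R] R(1) by (simp add: act.start_def)
      then have "int (p ^ e) dvd w R" by (rule mod_0_imp_dvd)
      then have "\<bar>int (p ^ e)\<bar> \<le> \<bar>w R\<bar>" by (rule dvd_imp_le_int[OF R(2)])
      then show False using bound unfolding abs_of_nat by linarith
    qed
  qed
  then show "\<exists>(K :: nat monoid) F. finite_p_group p K \<and> F \<in> epi H K \<and> F X \<noteq> \<one>\<^bsub>K\<^esub>"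
    by (rule ex_nat_p_quotient[OF p act.E.finite_p_group_series_perms[OF p HOL.refl] H.is_group F(1) X(1)])
qed

theorem mainTheorem5:
  fixes p :: nat and G :: "('a, 'b) monoid_scheme" and A :: "'a set"
    and a :: 'a and \<phi> :: "'a \<Rightarrow> 'a" and k :: int
  assumes "prime p"
    and "finite_p_group p G"
    and "a \<in> carrier G"
    and "A = generate G {a}"
    and "A \<noteq> {\<one>\<^bsub>G\<^esub>}"
    and "coprime k (int p)"
    and "\<phi> \<in> iso (G\<lparr>carrier := A\<rparr>) (G\<lparr>carrier := A\<rparr>)"
    and "\<phi> a = a [^]\<^bsub>G\<^esub> k"
  shows "residually_finite_p_group p (HNN G a (a [^]\<^bsub>G\<^esub> k)) \<longleftrightarrow> [k = 1] (mod int p)"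
proof -
  note p = assms(1)
  interpret group G using assms(2) by (simp add: finite_p_group_def)
  have fin: "finite (carrier G)" using assms(2) by (simp add: finite_p_group_def)
  have A: "subgroup A G" unfolding assms(4) using assms(3) by (intro generate_is_subgroup) simp
  have f_mult: "\<phi> (c \<otimes>\<^bsub>G\<^esub> d) = \<phi> c \<otimes>\<^bsub>G\<^esub> \<phi> d" if "c \<in> A" "d \<in> A" for c d
    using assms(7) that by (auto simp: iso_def hom_def)
  have f_bij: "bij_betw \<phi> A A" using assms(7) by (simp add: iso_def)
  have powers: "\<exists>i::int. c = a [^]\<^bsub>G\<^esub> i" if "c \<in> A" for c
    using that generate_pow[OF assms(3)] by (auto simp: assms(4))
  have A_comm: "c \<otimes>\<^bsub>G\<^esub> d = d \<otimes>\<^bsub>G\<^esub> c" if cd: "c \<in> A" "d \<in> A" for c d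
  proof -
    obtain i j :: int where "c = a [^]\<^bsub>G\<^esub> i" "d = a [^]\<^bsub>G\<^esub> j" using powers cd by metis
    then show ?thesis using assms(3) by (simp add: int_pow_mult[symmetric] add.commute)
  qed
  \<comment> \<open>This one-step series only serves to obtain an equivariant \<open>r\<close>, and
    with it \<open>twist\<close>, before anything is known about k modulo p.\<close>
  have triv: "exp_series (order G) G 1 (\<lambda>i. if i = 0 then {\<one>\<^bsub>G\<^esub>} else carrier G)"
    using pow_order_eq_1 one_is_normal normal_self by (auto simp: exp_series_def)
  interpret triv: finite_exp_series G "order G" 1 "\<lambda>i. if i = 0 then {\<one>\<^bsub>G\<^esub>} else carrier G"
    by unfold_locales (use fin triv in auto)
  obtain r where r: "\<And>x. x \<in> carrier G \<Longrightarrow> r x \<in> A"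
    "\<And>c x. c \<in> A \<Longrightarrow> x \<in> carrier G \<Longrightarrow> r (c \<otimes>\<^bsub>G\<^esub> x) = c \<otimes>\<^bsub>G\<^esub> r x"
    using triv.ex_equivariant_map[OF A] by metis
  interpret T: hnn_twist G A \<phi> r a
    by (intro hnn_twist.intro equivariant_twist.intro equivariant_twist_axioms.intro
        hnn_twist_axioms.intro) (fact is_group fin A f_mult f_bij r assms(3,4))+
  have f_pow: "\<phi> c = c [^]\<^bsub>G\<^esub> k" if c: "c \<in> A" for c
  proof -
    obtain i :: int where "c = a [^]\<^bsub>G\<^esub> i" using powers[OF c] by blast
    then show ?thesis
      using T.f_int_pow(2)[OF T.a_in_A] assms(3,8) by (simp add: int_pow_pow mult.commute)
  qed
  have "a \<noteq> \<one>\<^bsub>G\<^esub>" using assms(4,5) generate_one by metis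
  then have "[k = 1] (mod int p)" if "residually_finite_p_group p (HNN G a (\<phi> a))"
    using T.residually_p_imp_cong[OF p assms(6) _ f_pow that] by simp
  moreover have "residually_finite_p_group p (HNN G a (\<phi> a))" if k1: "[k = 1] (mod int p)"
  proof -
    obtain n N where N: "exp_series p G n N" using ex_exp_series[OF p assms(2)] by blast
    interpret finite_exp_series G p n N by unfold_locales (use fin N in auto)
    obtain m where m: "k - 1 = int p * m" using k1 by (auto simp: cong_iff_dvd_diff)
    have f_trivial: "\<phi> c \<otimes>\<^bsub>G\<^esub> inv\<^bsub>G\<^esub> c \<in> N i" if c: "c \<in> A" "c \<in> N (Suc i)" for c i
    proof -
      have cG: "c \<in> carrier G" using c A by (auto intro: subgroup.mem_carrier)
      have "\<phi> c \<otimes>\<^bsub>G\<^esub> inv\<^bsub>G\<^esub> c = c [^]\<^bsub>G\<^esub> (k - 1)"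
        using f_pow[OF c(1)] cG by (simp add: int_pow_diff)
      also have "\<dots> = (c [^]\<^bsub>G\<^esub> p) [^]\<^bsub>G\<^esub> m"
        using cG by (simp add: m int_pow_pow flip: int_pow_int)
      also have "\<dots> \<in> N i" by (rule subgroup_int_pow_closed[OF N_subgroup N_pow[OF c(2)]])
      finally show ?thesis .
    qed
    show ?thesis
      by (rule hnn_residually_p[OF p HOL.refl A assms(4,3)]) (fact f_mult f_bij A_comm f_trivial)+
  qed
  ultimately show ?thesis using assms(8) by auto
qed

end
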